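(* Let $\mathbf{X}=(X_n)_{n\in\mathbb{Z}}$ and $\mathbf{Y}=(Y_n)_{n\in\mathbb{Z}}$ be two stationary chains of infinite order on $\mathcal{A}=\{0,1\}$ with transition probabilities $p^X$ and $p^Y$ such that: $p^X(1\mid x_{-\infty}^{-1})\le p^Y(1\mid y_{-\infty}^{-1})$ whenever $x_{-\infty}^{-1}\le y_{-\infty}^{-1}$ (ordering); $\max\{\beta^X(k),\beta^Y(k)\}\to0$ as $k\to\infty$, where $\beta^X(k)=\max_{a\in\mathcal{A}}\sup\{|p^X(a\mid x_{-\infty}^{-1})-p^X(a\mid y_{-\infty}^{-1})|: x_{-k}^{-1}=y_{-k}^{-1}\}$ and similarly for $\beta^Y$ (continuity); and $\prod_{k\ge0}\alpha_k>0$, where the numbers $\alpha_k$ are defined from $p^X$ and $p^Y$ as in the context. Let $(\hat X_n,\hat Y_n)_{n\in\mathbb{Z}}$ be the bivariate process obtained by concatenating the independent strings $(\hat X_{T_i}^{T_{i+1}-1},\hat Y_{T_i}^{T_{i+1}-1})$, $i\in\mathbb{Z}$, constructed as in the context. Then $(\hat X_n,\hat Y_n)_{n\in\mathbb{Z}}$ is a stationary coupling of $\mathbf{X}$ and $\mathbf{Y}$ which attains the $\bar d$-distance between $\mathbf{X}$ and $\mathbf{Y}$, that is, $$\mathbb{P}(\hat X_0\neq \hat Y_0)=\bar d(\mathbf{X},\mathbf{Y}).$$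
   Context: **Distance.** For stationary processes $\mathbf{X},\mathbf{Y}$ on $\{0,1\}^{\mathbb{Z}}$, $$\bar d(\mathbf{X},\mathbf{Y})=\inf\{\mathbb{P}(\widetilde X_0\neq\widetilde Y_0): (\widetilde{\mathbf{X}},\widetilde{\mathbf{Y}})\text{ stationary coupling of }\mathbf{X}\text{ and }\mathbf{Y}\},$$ where a stationary coupling is a (jointly) stationary process on $(\{0,1\}\times\{0,1\})^{\mathbb{Z}}$ whose marginals have the laws of $\mathbf{X}$ and $\mathbf{Y}$. **Chains.** For integers $m\le n$, $x_m^n=(x_m,\dots,x_n)$; $x_{-\infty}^{-1}=(x_i)_{i\le -1}$ is called a past, and $\mathcal{A}_{-\infty}^{-1}$ is the set of pasts. $\mathbb{N}=\{0,1,2,\dots\}$. That $\mathbf{X}$ is a stationary chain of infinite order with transition probabilities $p^X$ means that $\mathbf X$ is stationary and $p^X(a\mid x_{-\infty}^{-1})$ is a (regular) version of $\mathbb{P}(X_0=a\mid X_{-\infty}^{-1}=x_{-\infty}^{-1})$, defined for every past and every $a\in\mathcal{A}$; similarly for $\mathbf{Y}$ and $p^Y$. Write $x_{-\infty}^{-1}\le y_{-\infty}^{-1}$ if $x_n\le y_n$ for all $n\le -1$. **Coupled kernel.** Let $\mathcal{S}=\{(0,0),(0,1),(1,1)\}$; $\mathcal{S}_{-\infty}^{-1}$ (resp. $\mathcal{S}_{-k}^{-1}$) is the set of $\mathcal S$-valued sequences indexed by $i\le-1$ (resp. $-k\le i\le -1$), identified with ordered pairs of pasts (resp. strings) $(x,y)$.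 For $(x_{-\infty}^{-1},y_{-\infty}^{-1})\in\mathcal{S}_{-\infty}^{-1}$ define $P((1,1)\mid(x_{-\infty}^{-1},y_{-\infty}^{-1}))=p^X(1\mid x_{-\infty}^{-1})$, $P((0,0)\mid(x_{-\infty}^{-1},y_{-\infty}^{-1}))=p^Y(0\mid y_{-\infty}^{-1})$, $P((0,1)\mid(x_{-\infty}^{-1},y_{-\infty}^{-1}))=p^X(0\mid x_{-\infty}^{-1})-p^Y(0\mid y_{-\infty}^{-1})$. For $(a,b)\in\mathcal{S}$ put $r_0((a,b))=\inf\{P((a,b)\mid w): w\in\mathcal{S}_{-\infty}^{-1}\}$, and for $k\ge1$, $r_k((a,b)\mid(x_{-k}^{-1},y_{-k}^{-1}))=\inf\{P((a,b)\mid(u_{-\infty}^{-1},v_{-\infty}^{-1})):(u_{-\infty}^{-1},v_{-\infty}^{-1})\in\mathcal{S}_{-\infty}^{-1},\,u_{-k}^{-1}=x_{-k}^{-1},\,v_{-k}^{-1}=y_{-k}^{-1}\}$. Put $\alpha_0=\sum_{(a,b)\in\mathcal{S}}r_0((a,b))$ and, for $k\ge1$, $\alpha_k=\inf\{\sum_{(a,b)\in\mathcal{S}}r_k((a,b)\mid(x_{-k}^{-1},y_{-k}^{-1})):(x_{-k}^{-1},y_{-k}^{-1})\in\mathcal{S}_{-k}^{-1}\}$. **Construction.** Let $\lambda_0=\alpha_0$ and $\lambda_k=\alpha_k-\alpha_{k-1}$ for $k\ge1$; since $\max\{\beta^X(k),\beta^Y(k)\}\to0$, $(\lambda_k)_{k\in\mathbb{N}}$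 is a probability distribution. Fix a probability measure $P_0$ on $\mathcal{S}$ and transition probabilities $P_k$ on $\mathcal{S}\times\mathcal{S}_{-k}^{-1}$, $k\ge1$, such that for all $(a,b)\in\mathcal{S}$ and $(x_{-\infty}^{-1},y_{-\infty}^{-1})\in\mathcal{S}_{-\infty}^{-1}$, $$P((a,b)\mid(x_{-\infty}^{-1},y_{-\infty}^{-1}))=\lambda_0P_0((a,b))+\sum_{k\ge1}\lambda_kP_k((a,b)\mid(x_{-k}^{-1},y_{-k}^{-1})).$$ Let $(L_n)_{n\in\mathbb{Z}}$ be iid with $\mathbb{P}(L_n=k)=\lambda_k$, $k\in\mathbb N$. Let $T_0=\sup\{z\le0: L_{z+m}\le m\ \forall m\ge0\}$ and, for $n\ge1$, $T_{-n}=\sup\{z<T_{-n+1}: L_{z+m}\le m\ \forall m\ge0\}$, $T_n=\inf\{z>T_{n-1}: L_{z+m}\le m\ \forall m\ge0\}$ (almost surely all $T_n$ are finite). Given $(L_n)_{n\in\mathbb Z}$, and hence $(T_j)_{j\in\mathbb Z}$, the strings $(\hat X_{T_j}^{T_{j+1}-1},\hat Y_{T_j}^{T_{j+1}-1})$, $j\in\mathbb{Z}$, are generated independently of each other, each as follows: (1) choose $(\hat X_{T_j},\hat Y_{T_j})\in\mathcal{S}$ with law $P_0$; (2) successively for $n=T_j+1,\dots,T_{j+1}-1$, choose $(\hat X_n,\hat Y_n)\in\mathcal{S}$ with law $P_{L_n}(\cdot\mid(\hat X_{n-L_n}^{n-1},\hat Y_{n-L_n}^{n-1}))$ (law $P_0$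 if $L_n=0$). Note that $n-L_n\ge T_j$ for $T_j\le n<T_{j+1}$. *)

theory Defs
  imports "HOL-Probability.Probability"
begin

text \<open>
  The alphabet \<open>{0,1}\<close> is \<^typ>\<open>bool\<close> with its order \<open>False < True\<close>.  A past \<open>(x\<^sub>i)\<^sub>i\<^sub>\<le>\<^sub>-\<^sub>1\<close> is a function
  \<open>u :: nat \<Rightarrow> 'b\<close> that reads the sequence backwards in time, \<open>u i = x\<^bsub>-1-i\<^esub>\<close>; likewise a string
  \<open>(x\<^bsub>-k\<^esub>, \<dots>, x\<^bsub>-1\<^esub>)\<close> is a list of length \<open>k\<close> with the most recent symbol first.
\<close>

definition past_at :: "(int \<Rightarrow> 'b) \<Rightarrow> int \<Rightarrow> nat \<Rightarrow> 'b" where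
  "past_at x n = (\<lambda>i. x (n - 1 - int i))"

definition recent :: "nat \<Rightarrow> (nat \<Rightarrow> 'b) \<Rightarrow> 'b list" where
  "recent k u = map u [0..<k]"

abbreviation seq_space :: "('i \<Rightarrow> 'b) measure" where
  "seq_space \<equiv> PiM UNIV (\<lambda>_. count_space UNIV)"

definition process_law :: "'a measure \<Rightarrow> (int \<Rightarrow> 'a \<Rightarrow> 'b) \<Rightarrow> (int \<Rightarrow> 'b) measure" where
  "process_law M X = distr M seq_space (\<lambda>\<omega> n. X n \<omega>)"

definition stationary_process :: "'a measure \<Rightarrow> (int \<Rightarrow> 'a \<Rightarrow> 'b) \<Rightarrow> bool" where
  "stationary_process M X \<longleftrightarrow>
     prob_space M \<and> (\<forall>n. X n \<in> measurable M (count_space UNIV)) \<and>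
     (\<forall>m. process_law M (\<lambda>n. X (n + m)) = process_law M X)"

definition stationary_coupling ::
  "'c measure \<Rightarrow> (int \<Rightarrow> 'c \<Rightarrow> bool \<times> bool) \<Rightarrow> (int \<Rightarrow> bool) measure \<Rightarrow> (int \<Rightarrow> bool) measure \<Rightarrow> bool"
where
  "stationary_coupling C Z \<mu> \<nu> \<longleftrightarrow>
     stationary_process C Z \<and>
     process_law C (\<lambda>n \<omega>. fst (Z n \<omega>)) = \<mu> \<and>
     process_law C (\<lambda>n \<omega>. snd (Z n \<omega>)) = \<nu>"

text \<open>Couplings matter only through their laws, so they range over coordinate processes.\<close>

definition dbar :: "(int \<Rightarrow> bool) measure \<Rightarrow> (int \<Rightarrow> bool) measure \<Rightarrow> real" where
  "dbar \<mu> \<nu> = Inf {measure C {w \<in> space C. fst (w 0) \<noteq> snd (w 0)} | C :: (int \<Rightarrow> bool \<times> bool) measure.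
                    stationary_coupling C (\<lambda>n w. w n) \<mu> \<nu>}"

definition past_algebra :: "'a measure \<Rightarrow> (int \<Rightarrow> 'a \<Rightarrow> 'b) \<Rightarrow> 'a measure" where
  "past_algebra M X = vimage_algebra (space M) (\<lambda>\<omega>. past_at (\<lambda>n. X n \<omega>) 0) seq_space"

definition stationary_chain ::
  "'a measure \<Rightarrow> (int \<Rightarrow> 'a \<Rightarrow> bool) \<Rightarrow> ((nat \<Rightarrow> bool) \<Rightarrow> bool pmf) \<Rightarrow> bool"
where
  "stationary_chain M X p \<longleftrightarrow>
     stationary_process M X \<and>
     (\<forall>a. (\<lambda>u. pmf (p u) a) \<in> borel_measurable seq_space) \<and>
     (\<forall>a. AE \<omega> in M.
        real_cond_exp M (past_algebra M X) (indicator {\<omega> \<in> space M. X 0 \<omega> = a}) \<omega>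
          = pmf (p (past_at (\<lambda>n. X n \<omega>) 0)) a)"

definition beta :: "((nat \<Rightarrow> bool) \<Rightarrow> bool pmf) \<Rightarrow> nat \<Rightarrow> real" where
  "beta p k = (MAX a. Sup {\<bar>pmf (p u) a - pmf (p v) a\<bar> | u v. \<forall>i<k. u i = v i})"

definition ordered_pairs :: "(bool \<times> bool) set" where
  "ordered_pairs = {(False, False), (False, True), (True, True)}"

definition ordered_pasts :: "(nat \<Rightarrow> bool \<times> bool) set" where
  "ordered_pasts = {w. \<forall>i. w i \<in> ordered_pairs}"

definition ordered_strings :: "nat \<Rightarrow> (bool \<times> bool) list set" where
  "ordered_strings k = {h. length h = k \<and> set h \<subseteq> ordered_pairs}"

text \<open>The value at \<open>(True, False)\<close>, which is not an ordered pair, is irrelevant.\<close>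

fun coupled_kernel ::
  "((nat \<Rightarrow> bool) \<Rightarrow> bool pmf) \<Rightarrow> ((nat \<Rightarrow> bool) \<Rightarrow> bool pmf)
     \<Rightarrow> bool \<times> bool \<Rightarrow> (nat \<Rightarrow> bool \<times> bool) \<Rightarrow> real"
where
  "coupled_kernel pX pY (True, True) w = pmf (pX (fst \<circ> w)) True"
| "coupled_kernel pX pY (False, False) w = pmf (pY (snd \<circ> w)) False"
| "coupled_kernel pX pY (False, True) w = pmf (pX (fst \<circ> w)) False - pmf (pY (snd \<circ> w)) False"
| "coupled_kernel pX pY (True, False) w = 0"

text \<open>
  The order \<open>k\<close> is the length of the string; for the empty string this is the infimum over all
  ordered pasts, so that \<open>alpha pX pY 0\<close> is \<open>\<alpha>\<^sub>0\<close>.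
\<close>

definition kernel_inf ::
  "((nat \<Rightarrow> bool) \<Rightarrow> bool pmf) \<Rightarrow> ((nat \<Rightarrow> bool) \<Rightarrow> bool pmf)
     \<Rightarrow> bool \<times> bool \<Rightarrow> (bool \<times> bool) list \<Rightarrow> real"
where
  "kernel_inf pX pY s h =
     Inf {coupled_kernel pX pY s w | w. w \<in> ordered_pasts \<and> recent (length h) w = h}"

definition alpha ::
  "((nat \<Rightarrow> bool) \<Rightarrow> bool pmf) \<Rightarrow> ((nat \<Rightarrow> bool) \<Rightarrow> bool pmf) \<Rightarrow> nat \<Rightarrow> real"
where
  "alpha pX pY k = Inf {\<Sum>s\<in>ordered_pairs. kernel_inf pX pY s h | h. h \<in> ordered_strings k}"

definition lag_prob ::
  "((nat \<Rightarrow> bool) \<Rightarrow> bool pmf) \<Rightarrow> ((nat \<Rightarrow> bool) \<Rightarrow> bool pmf) \<Rightarrow> nat \<Rightarrow> real"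
where
  "lag_prob pX pY k = (if k = 0 then alpha pX pY 0 else alpha pX pY k - alpha pX pY (k - 1))"

text \<open>
  A single map \<open>P\<close> on strings represents \<open>P\<^sub>0 = P []\<close> and all \<open>P\<^sub>k\<close>, the latter being the restriction
  of \<open>P\<close> to strings of length \<open>k\<close>.
\<close>

definition kernel_mixture ::
  "((nat \<Rightarrow> bool) \<Rightarrow> bool pmf) \<Rightarrow> ((nat \<Rightarrow> bool) \<Rightarrow> bool pmf)
     \<Rightarrow> ((bool \<times> bool) list \<Rightarrow> (bool \<times> bool) pmf) \<Rightarrow> bool"
where
  "kernel_mixture pX pY P \<longleftrightarrow>
     (\<forall>k. \<forall>h \<in> ordered_strings k. set_pmf (P h) \<subseteq> ordered_pairs) \<and>
     (\<forall>s \<in> ordered_pairs. \<forall>w \<in> ordered_pasts.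
        (\<lambda>k. lag_prob pX pY k * pmf (P (recent k w)) s) sums coupled_kernel pX pY s w)"

definition regeneration :: "(int \<Rightarrow> nat) \<Rightarrow> int \<Rightarrow> bool" where
  "regeneration l z \<longleftrightarrow> (\<forall>m. l (z + int m) \<le> m)"

text \<open>
  Suprema and infima on \<^typ>\<open>int\<close> are unspecified when not attained; here that concerns only the
  event that some regeneration time is infinite.
\<close>

primrec regen_backward :: "(int \<Rightarrow> nat) \<Rightarrow> nat \<Rightarrow> int" where
  "regen_backward l 0 = Sup {z. z \<le> 0 \<and> regeneration l z}"
| "regen_backward l (Suc n) = Sup {z. z < regen_backward l n \<and> regeneration l z}"

primrec regen_forward :: "(int \<Rightarrow> nat) \<Rightarrow> nat \<Rightarrow> int" where
  "regen_forward l 0 = regen_backward l 0"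
| "regen_forward l (Suc n) = Inf {z. z > regen_forward l n \<and> regeneration l z}"

definition regen_time :: "(int \<Rightarrow> nat) \<Rightarrow> int \<Rightarrow> int" where
  "regen_time l j = (if 0 \<le> j then regen_forward l (nat j) else regen_backward l (nat (- j)))"

text \<open>
  The law of the string generated on the times \<open>t, \<dots>, t' - 1\<close>: the first symbol has law \<open>P\<^sub>0\<close>, and the
  symbol at a later time \<open>n\<close> is drawn given the \<open>l n\<close> preceding ones.
\<close>

primrec extend_string ::
  "('s list \<Rightarrow> 's pmf) \<Rightarrow> nat list \<Rightarrow> 's list \<Rightarrow> 's list pmf"
where
  "extend_string P [] h = return_pmf h"
| "extend_string P (k # ks) h = bind_pmf (P (take k h)) (\<lambda>s. extend_string P ks (s # h))"

definition string_law :: "('s list \<Rightarrow> 's pmf) \<Rightarrow> (int \<Rightarrow> nat) \<Rightarrow> int \<Rightarrow> int \<Rightarrow> 's list pmf" where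
  "string_law P l t t' = bind_pmf (P []) (\<lambda>s. extend_string P (map l [t+1..t'-1]) [s])"

definition regen_string :: "(int \<Rightarrow> nat) \<Rightarrow> (int \<Rightarrow> 's) \<Rightarrow> int \<Rightarrow> 's list" where
  "regen_string l x j =
     recent (nat (regen_time l (j + 1) - regen_time l j)) (past_at x (regen_time l (j + 1)))"

text \<open>
  The last clause states that, conditionally on the whole sequence \<open>L\<close>, the strings of \<open>Z\<close> between
  successive regeneration times are independent with laws \<^const>\<open>string_law\<close>.
\<close>

definition regenerative_construction ::
  "'c measure \<Rightarrow> (nat \<Rightarrow> real) \<Rightarrow> ('s list \<Rightarrow> 's pmf)
     \<Rightarrow> (int \<Rightarrow> 'c \<Rightarrow> nat) \<Rightarrow> (int \<Rightarrow> 'c \<Rightarrow> 's) \<Rightarrow> bool"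
where
  "regenerative_construction C q P L Z \<longleftrightarrow>
     prob_space C \<and>
     prob_space.indep_vars C (\<lambda>_. count_space UNIV) L UNIV \<and>
     (\<forall>n k. measure C {\<omega> \<in> space C. L n \<omega> = k} = q k) \<and>
     (\<forall>n. Z n \<in> measurable C (count_space UNIV)) \<and>
     (\<forall>J z. finite J \<longrightarrow>
        (AE \<omega> in C.
           real_cond_exp C (vimage_algebra (space C) (\<lambda>\<omega> n. L n \<omega>) seq_space)
             (indicator {\<omega> \<in> space C. \<forall>j\<in>J. regen_string (\<lambda>n. L n \<omega>) (\<lambda>n. Z n \<omega>) j = z j}) \<omega>
           = (\<Prod>j\<in>J. pmf (string_law P (\<lambda>n. L n \<omega>)
                (regen_time (\<lambda>n. L n \<omega>) j) (regen_time (\<lambda>n. L n \<omega>) (j + 1))) (z j))))"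

end

theory Submission
  imports Defs
begin

text \<open>
  Both chains are compared with the kernel \<open>transition w\<close>, the mixture over \<open>k\<close> of the laws \<open>P\<^sub>k\<close> given the
  \<open>k\<close> most recent symbols of \<open>w\<close>.  Run this kernel from time \<open>b - N\<close> to time \<open>b\<close>, started from an
  arbitrary past \<open>w\<close> and driven by the lags \<open>L\<^bsub>b-N\<^esub>, \<dots>, L\<^bsub>b-1\<^esub>\<close>.  If there is a regeneration time
  in \<open>[b - N, b - n]\<close>, then the last \<open>n\<close> symbols do not depend on \<open>w\<close> and their conditional law given the lags
  is that of the regenerative process.  Regenerations happen almost surely infinitely often in both directions
  (Kolmogorov's 0-1 law towards the future, shift invariance of the lags towards the past), so the law of a block
  of the process is the limit of its law under the run from \<open>w\<close>, uniformly in \<open>w\<close> and whatever the position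
  of the block.  This yields stationarity.  Projecting the run to a coordinate gives the run of \<open>pX\<close> or
  \<open>pY\<close>, and the law of the past of \<open>X\<close> is invariant under the run of \<open>pX\<close>; averaging the uniform
  approximation over that law identifies the marginals.  Finally \<open>fst (Z 0) \<le> snd (Z 0)\<close> almost surely,
  and an ordered coupling attains the lower bound \<open>P(Y\<^sub>0 = 1) - P(X\<^sub>0 = 1)\<close> of every coupling.
\<close>

section \<open>Strings and pasts\<close>

lemma length_recent [simp]: "length (recent k u) = k"
  by (simp add: recent_def)

lemma recent_0 [simp]: "recent 0 u = []"
  by (simp add: recent_def)

lemma nth_recent: "i < k \<Longrightarrow> recent k u ! i = u i"
  by (simp add: recent_def)

lemma take_recent: "j \<le> k \<Longrightarrow> take j (recent k u) = recent j u"
  by (simp add: recent_def take_map)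

lemma recent_Suc_case_nat: "recent (Suc k) (case_nat s u) = s # recent k u"
  by (rule nth_equalityI) (auto simp: nth_recent nth_Cons split: nat.splits)

lemma recent_comp: "recent k (f \<circ> u) = map f (recent k u)"
  by (simp add: recent_def)

lemma recent_past_at_add:
  "recent (j + k) (past_at x b) = recent j (past_at x b) @ recent k (past_at x (b - int j))"
proof (rule nth_equalityI)
  fix i assume "i < length (recent (j + k) (past_at x b))"
  then show "recent (j + k) (past_at x b) ! i
      = (recent j (past_at x b) @ recent k (past_at x (b - int j))) ! i"
    by (cases "i < j") (auto simp: nth_recent nth_append past_at_def algebra_simps)
qed simp

lemma case_nat_past_at: "case_nat (x b) (past_at x b) = past_at x (b + 1)"
  by (rule ext) (auto simp: past_at_def algebra_simps split: nat.splits)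

lemma measurable_past_at [measurable]: "(\<lambda>x. past_at x b) \<in> measurable seq_space seq_space"
  unfolding past_at_def by (rule measurable_PiM_single') (auto simp: space_PiM)

lemma measurable_recent [measurable]:
  "recent k \<in> measurable seq_space (count_space (UNIV :: 'b::countable list set))"
proof (induction k)
  case 0
  then show ?case by (simp add: recent_def)
next
  case (Suc k)
  have "recent (Suc k) = (\<lambda>u. recent k u @ [u k :: 'b])"
    by (simp add: recent_def fun_eq_iff)
  moreover have "(\<lambda>u. recent k u @ [u k :: 'b]) \<in> measurable seq_space (count_space UNIV)"
    using Suc.IH by measurable
  ultimately show ?case by simp
qed

lemma measurable_case_nat_seq [measurable]:
  "case_nat s \<in> measurable seq_space (seq_space :: (nat \<Rightarrow> 'b) measure)"
proof (rule measurable_PiM_single')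
  fix i :: nat
  show "(\<lambda>u. case_nat s u i) \<in> measurable seq_space (count_space (UNIV :: 'b set))"
    by (cases i) auto
qed (auto simp: space_PiM)

text \<open>Cylinder sets determine a law on sequences, and finitely many times always lie in one
  window of consecutive times, so events about blocks suffice.\<close>

lemma seq_law_eqI:
  fixes \<mu> \<nu> :: "(int \<Rightarrow> 'b::countable) measure"
  assumes "prob_space \<mu>" "prob_space \<nu>"
    and sets: "sets \<mu> = sets seq_space" "sets \<nu> = sets seq_space"
    and eq: "\<And>k b S. measure \<mu> {x. recent k (past_at x b) \<in> S} = measure \<nu> {x. recent k (past_at x b) \<in> S}"
  shows "\<mu> = \<nu>"
proof -
  interpret \<mu>: prob_space \<mu> by fact
  interpret \<nu>: prob_space \<nu> by fact
  show ?thesis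
  proof (rule measure_eqI_PiM_infinite[OF sets])
    fix J :: "int set" and A assume J: "finite J" and "\<And>i. i \<in> J \<Longrightarrow> A i \<in> sets (count_space (UNIV::'b set))"
    obtain c where c: "\<And>j. j \<in> J \<Longrightarrow> \<bar>j\<bar> \<le> c"
      using J by (metis finite_imageI Max_ge imageI)
    \<comment> \<open>The block of length \<open>k\<close> before time \<open>c + 1\<close> covers
      the times from \<open>-c\<close> to \<open>c\<close>. Read backwards, it has the symbol at
      time \<open>j\<close> in position \<open>c - j\<close>.\<close>
    define k where "k = nat (2 * c + 1)"
    define S where "S = {h. \<forall>j\<in>J. h ! nat (c - j) \<in> A j}"
    have "recent k (past_at x (c + 1)) ! nat (c - j) = x j" if "j \<in> J" for j and x :: "int \<Rightarrow> 'b"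
      using c[OF that] by (subst nth_recent) (auto simp: k_def past_at_def)
    then have "prod_emb UNIV (\<lambda>_. count_space UNIV) J (Pi\<^sub>E J A) = {x. recent k (past_at x (c + 1)) \<in> S}"
      by (auto simp: prod_emb_def S_def PiE_iff)
    then show "emeasure \<mu> (prod_emb UNIV (\<lambda>_. count_space UNIV) J (Pi\<^sub>E J A))
        = emeasure \<nu> (prod_emb UNIV (\<lambda>_. count_space UNIV) J (Pi\<^sub>E J A))"
      by (simp add: \<mu>.emeasure_eq_measure \<nu>.emeasure_eq_measure eq)
  qed (rule \<mu>.finite_measure_axioms)
qed

section \<open>Finite strings driven by prescribed lags\<close>

lemma extend_string_append:
  "extend_string P (ks @ ks') h = bind_pmf (extend_string P ks h) (extend_string P ks')"
  by (induction ks arbitrary: h) (auto simp: bind_return_pmf bind_assoc_pmf)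

lemma set_pmf_extend_string:
  "h' \<in> set_pmf (extend_string P ks h) \<Longrightarrow> length h' = length ks + length h \<and> drop (length ks) h' = h"
proof (induction ks arbitrary: h)
  case (Cons k ks)
  then obtain s where "h' \<in> set_pmf (extend_string P ks (s # h))" by auto
  from Cons.IH[OF this] show ?case
    by (simp add: drop_Suc tl_drop[symmetric])
qed simp

text \<open>At step \<open>i\<close> there are \<open>i + length h\<close> symbols in front of
  \<open>g\<close>. A lag bounded by this number never reads \<open>g\<close>, which is carried
  along unchanged.\<close>

lemma extend_string_prefix:
  assumes "\<And>i. i < length ks \<Longrightarrow> ks ! i \<le> i + length h"
  shows "extend_string P ks (h @ g) = map_pmf (\<lambda>h'. h' @ g) (extend_string P ks h)"
  using assms
proof (induction ks arbitrary: h)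
  case (Cons k ks)
  have "k \<le> length h" using Cons.prems[of 0] by simp
  moreover have "extend_string P ks (s # h @ g) = map_pmf (\<lambda>h'. h' @ g) (extend_string P ks (s # h))" for s
    using Cons.IH[of "s # h"] Cons.prems[of "Suc _"] by simp
  ultimately show ?case by (simp add: map_bind_pmf)
qed simp

text \<open>No step of \<open>ks'\<close> looks back beyond the start of \<open>ks'\<close>, so what
  it generates is independent of what \<open>ks\<close> has produced. Newer symbols come first in a
  string, hence \<open>h' @ h\<close> against \<open>ks @ ks'\<close>.\<close>

lemma pmf_extend_string_append:
  assumes "\<And>i. i < length ks' \<Longrightarrow> ks' ! i \<le> i" and len: "length h' = length ks'"
  shows "pmf (extend_string P (ks @ ks') g) (h' @ h)
    = pmf (extend_string P ks g) h * pmf (extend_string P ks' []) h'"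
proof -
  have "pmf (extend_string P ks' h1) (h' @ h) = pmf (extend_string P ks' []) h' * indicator {h} h1" for h1
  proof -
    have "extend_string P ks' h1 = map_pmf (\<lambda>h. h @ h1) (extend_string P ks' [])"
      using extend_string_prefix[of ks' "[]" P h1] assms(1) by simp
    \<comment> \<open>The length of \<open>ks'\<close> fixes where \<open>h' @ h\<close> is cut, so
      only \<open>h1 = h\<close> contributes.\<close>
    moreover have "pmf (map_pmf (\<lambda>h. h @ h1) (extend_string P ks' [])) (h' @ h) = 0" if "h1 \<noteq> h"
    proof (rule ccontr)
      assume "pmf (map_pmf (\<lambda>h. h @ h1) (extend_string P ks' [])) (h' @ h) \<noteq> 0"
      then obtain h2 where "h2 \<in> set_pmf (extend_string P ks' [])" "h' @ h = h2 @ h1"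
        by (auto simp: pmf_eq_0_set_pmf)
      with len that show False using set_pmf_extend_string[of h2 P ks' "[]"] by simp
    qed
    moreover have "pmf (map_pmf (\<lambda>h'. h' @ h) (extend_string P ks' [])) (h' @ h) = pmf (extend_string P ks' []) h'"
      by (rule pmf_map_inj') (simp add: inj_def)
    ultimately show ?thesis by (auto simp: indicator_def)
  qed
  then show ?thesis
    by (simp add: extend_string_append pmf_bind measure_pmf_single)
qed

text \<open>\<open>string_law\<close> takes its first symbol from \<open>P []\<close> without
  consulting \<open>l t\<close>; a lag 0 makes \<open>extend_string\<close> draw from the same
  law.\<close>

lemma string_law_eq_extend_string:
  assumes "l t = 0" "t < t'"
  shows "string_law P l t t' = extend_string P (map l [t..t' - 1]) []"
  using assms by (simp add: string_law_def upto_rec1[of t])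

text \<open>By \<open>pmf_extend_string_append\<close>, a regeneration at each \<open>t i\<close>
  with \<open>i < r\<close> makes the law of the concatenated string factor. The conjunct
  \<open>t 0 \<le> t r\<close> is carried through the induction to split lengths and
  intervals.\<close>

lemma prod_string_law:
  fixes t :: "nat \<Rightarrow> int"
  assumes "\<And>i. i < r \<Longrightarrow> t i < t (Suc i)" and "\<And>i. i < r \<Longrightarrow> regeneration l (t i)"
  shows "(\<Prod>i<r. pmf (string_law P l (t i) (t (Suc i)))
            (recent (nat (t (Suc i) - t i)) (past_at x (t (Suc i)))))
    = pmf (extend_string P (map l [t 0..t r - 1]) []) (recent (nat (t r - t 0)) (past_at x (t r)))
      \<and> t 0 \<le> t r"
  using assms
proof (induction r)
  case (Suc r)
  then have IH: "(\<Prod>i<r. pmf (string_law P l (t i) (t (Suc i)))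
            (recent (nat (t (Suc i) - t i)) (past_at x (t (Suc i)))))
    = pmf (extend_string P (map l [t 0..t r - 1]) []) (recent (nat (t r - t 0)) (past_at x (t r)))"
    and le: "t 0 \<le> t r" by auto
  have less: "t r < t (Suc r)" and reg: "regeneration l (t r)" using Suc.prems by auto
  have r0: "l (t r + int m) \<le> m" for m using reg by (auto simp: regeneration_def)
  have "nat (t (Suc r) - t 0) = nat (t (Suc r) - t r) + nat (t r - t 0)"
    using less le by linarith
  then have "recent (nat (t (Suc r) - t 0)) (past_at x (t (Suc r)))
     = recent (nat (t (Suc r) - t r)) (past_at x (t (Suc r))) @ recent (nat (t r - t 0)) (past_at x (t r))"
    using less by (simp add: recent_past_at_add)
  moreover have "[t 0..t (Suc r) - 1] = [t 0..t r - 1] @ [t r..t (Suc r) - 1]"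
    using upto_split1[of "t 0" "t r" "t (Suc r) - 1"] less le by simp
  moreover have "pmf (extend_string P (map l [t 0..t r - 1] @ map l [t r..t (Suc r) - 1]) [])
      (recent (nat (t (Suc r) - t r)) (past_at x (t (Suc r))) @ recent (nat (t r - t 0)) (past_at x (t r)))
    = pmf (extend_string P (map l [t 0..t r - 1]) []) (recent (nat (t r - t 0)) (past_at x (t r)))
      * pmf (extend_string P (map l [t r..t (Suc r) - 1]) []) (recent (nat (t (Suc r) - t r)) (past_at x (t (Suc r))))"
    using less r0 by (intro pmf_extend_string_append) (auto simp: nth_upto)
  moreover have "string_law P l (t r) (t (Suc r)) = extend_string P (map l [t r..t (Suc r) - 1]) []"
    using less r0[of 0] by (intro string_law_eq_extend_string) auto
  ultimately show ?case using IH less le by simp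
qed simp

section \<open>Infinite pasts extended by prescribed lags\<close>

primrec extend_past :: "('s list \<Rightarrow> 's pmf) \<Rightarrow> nat list \<Rightarrow> (nat \<Rightarrow> 's) \<Rightarrow> (nat \<Rightarrow> 's) pmf" where
  "extend_past P [] w = return_pmf w"
| "extend_past P (k # ks) w = bind_pmf (P (recent k w)) (\<lambda>s. extend_past P ks (case_nat s w))"

lemma extend_past_append:
  "extend_past P (ks @ ks') w = bind_pmf (extend_past P ks w) (extend_past P ks')"
  by (induction ks arbitrary: w) (auto simp: bind_return_pmf bind_assoc_pmf)

text \<open>The bound keeps every look-back within the \<open>j\<close> latest symbols of
  \<open>w\<close> and those generated since. There \<open>recent k\<close> and
  \<open>take k\<close> agree, whereas for longer lags \<open>take\<close> would truncate.\<close>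

lemma map_recent_extend_past:
  assumes "\<And>i. i < length ks \<Longrightarrow> ks ! i \<le> i + j"
  shows "map_pmf (recent (length ks + j)) (extend_past P ks w) = extend_string P ks (recent j w)"
  using assms
proof (induction ks arbitrary: j w)
  case (Cons k ks)
  have "k \<le> j" using Cons.prems[of 0] by simp
  moreover have "map_pmf (recent (length ks + Suc j)) (extend_past P ks (case_nat s w))
      = extend_string P ks (s # recent j w)" for s
    using Cons.IH[of "Suc j" "case_nat s w"] Cons.prems[of "Suc _"] by (simp add: recent_Suc_case_nat)
  ultimately show ?case by (simp add: map_bind_pmf take_recent)
qed simp

text \<open>From the regeneration time \<open>u\<close> on, no lag reads a symbol before
  \<open>u\<close>, so both \<open>w\<close> and the symbols generated before \<open>u\<close> are
  forgotten.\<close>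

lemma map_recent_extend_past_regeneration:
  assumes "regeneration l u" "b - int N \<le> u" "u \<le> b - int n"
  shows "map_pmf (recent n) (extend_past P (map l [b - int N..b - 1]) w)
    = map_pmf (take n) (extend_string P (map l [u..b - 1]) [])"
proof -
  define ks where "ks = map l [u..b - 1]"
  have "[b - int N..b - 1] = [b - int N..u - 1] @ [u..b - 1]"
    using upto_split1[of "b - int N" u "b - 1"] assms by (cases "u = b") auto
  moreover have "map_pmf (recent n) (extend_past P ks w') = map_pmf (take n) (extend_string P ks [])" for w'
  proof -
    have "map_pmf (recent (length ks + 0)) (extend_past P ks w') = extend_string P ks (recent 0 w')"
      using assms(1) by (intro map_recent_extend_past) (auto simp: ks_def nth_upto regeneration_def)
    then have "map_pmf (take n) (extend_string P ks []) = map_pmf (take n \<circ> recent (length ks)) (extend_past P ks w')"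
      by (simp flip: pmf.map_comp)
    moreover have "take n \<circ> recent (length ks) = recent n"
      using assms(3) by (auto simp: ks_def take_recent fun_eq_iff)
    ultimately show ?thesis by metis
  qed
  ultimately show ?thesis
    by (simp add: extend_past_append map_bind_pmf flip: ks_def)
qed

text \<open>Later steps only put symbols in front. This serves to discard the symbols generated
  after a given block.\<close>

lemma map_drop_extend_string:
  "map_pmf (drop (length ks')) (extend_string P (ks @ ks') h) = extend_string P ks h"
proof -
  have "map_pmf (drop (length ks')) (extend_string P ks' g) = return_pmf g" for g
    using set_pmf_extend_string[of _ P ks' g]
    by (subst map_pmf_cong[where g = "\<lambda>_. g", OF refl]) (auto simp: map_pmf_const)
  then show ?thesis
    by (simp add: extend_string_append map_bind_pmf bind_return_pmf')
qed

section \<open>Markov chains on pasts\<close>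

primrec run :: "((nat \<Rightarrow> 's) \<Rightarrow> 's pmf) \<Rightarrow> nat \<Rightarrow> (nat \<Rightarrow> 's) \<Rightarrow> (nat \<Rightarrow> 's) pmf" where
  "run p 0 w = return_pmf w"
| "run p (Suc n) w = bind_pmf (p w) (\<lambda>s. run p n (case_nat s w))"

text \<open>The lags being iid, each can be drawn just before the symbol that it governs. Averaging
  over them turns the driven extension into a Markov chain on pasts.\<close>

lemma bind_replicate_pmf_extend_past:
  "bind_pmf (replicate_pmf n q) (\<lambda>ks. extend_past P ks w) = run (\<lambda>w. bind_pmf q (\<lambda>k. P (recent k w))) n w"
proof (induction n arbitrary: w)
  case (Suc n)
  have "bind_pmf (replicate_pmf (Suc n) q) (\<lambda>ks. extend_past P ks w)
     = bind_pmf q (\<lambda>k. bind_pmf (replicate_pmf n q) (\<lambda>ks. bind_pmf (P (recent k w)) (\<lambda>s. extend_past P ks (case_nat s w))))"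
    by (simp add: bind_assoc_pmf bind_return_pmf)
  \<comment> \<open>The remaining lags are independent of the current symbol, so the two draws are
    exchanged.\<close>
  also have "\<dots> = bind_pmf q (\<lambda>k. bind_pmf (P (recent k w)) (\<lambda>s. bind_pmf (replicate_pmf n q) (\<lambda>ks. extend_past P ks (case_nat s w))))"
    by (rule bind_pmf_cong[OF refl], rule bind_commute_pmf)
  finally show ?case by (simp add: Suc.IH bind_assoc_pmf)
qed (simp add: bind_return_pmf)

text \<open>Lumping of a Markov chain: a projection that commutes with one step commutes with any
  number of steps. The closed set \<open>W\<close> will be the set of ordered pasts, where the
  coupled kernel has the right marginals.\<close>

lemma map_run:
  assumes "\<And>v. v \<in> W \<Longrightarrow> map_pmf f (p v) = p' (f \<circ> v)"
    and "\<And>v s. v \<in> W \<Longrightarrow> s \<in> set_pmf (p v) \<Longrightarrow> case_nat s v \<in> W"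
    and "w \<in> W"
  shows "map_pmf ((\<circ>) f) (run p n w) = run p' n (f \<circ> w)"
  using assms(3)
proof (induction n arbitrary: w)
  case (Suc n)
  have "case_nat (f s) (f \<circ> w) = f \<circ> case_nat s w" for s
    by (auto simp: fun_eq_iff split: nat.splits)
  then have "map_pmf ((\<circ>) f) (run p n (case_nat s w)) = run p' n (case_nat (f s) (f \<circ> w))"
    if "s \<in> set_pmf (p w)" for s
    using Suc.IH[OF assms(2)[OF Suc.prems that]] by (simp only: \<open>case_nat (f s) (f \<circ> w) = f \<circ> case_nat s w\<close>)
  then have "bind_pmf (p w) (\<lambda>s. map_pmf ((\<circ>) f) (run p n (case_nat s w)))
      = bind_pmf (p w) (\<lambda>s. run p' n (case_nat (f s) (f \<circ> w)))"
    by (intro bind_pmf_cong) auto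
  also have "\<dots> = bind_pmf (map_pmf f (p w)) (\<lambda>s. run p' n (case_nat s (f \<circ> w)))"
    by (simp only: bind_map_pmf)
  also have "\<dots> = run p' (Suc n) (f \<circ> w)"
    by (simp only: assms(1)[OF Suc.prems] run.simps)
  finally show ?case by (simp only: map_bind_pmf run.simps)
qed simp

lemma set_pmf_run:
  assumes "\<And>v s. v \<in> W \<Longrightarrow> s \<in> set_pmf (p v) \<Longrightarrow> case_nat s v \<in> W" and "w \<in> W"
  shows "set_pmf (run p n w) \<subseteq> W"
  using assms(2) by (induction n arbitrary: w) (use assms(1) in auto)

section \<open>Regeneration times\<close>

lemma Sup_int_in: "X \<noteq> {} \<Longrightarrow> bdd_above X \<Longrightarrow> Sup X \<in> X" for X :: "int set"
proof -
  assume "X \<noteq> {}" "bdd_above X"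
  then obtain x where "x \<in> X" "Sup X - 1 < x" "x \<le> Sup X"
    using less_cSup_iff[of X "Sup X - 1"] cSup_upper[of _ X] by auto
  moreover from this have "x = Sup X" by linarith
  ultimately show ?thesis by simp
qed

lemma Inf_int_in: "X \<noteq> {} \<Longrightarrow> bdd_below X \<Longrightarrow> Inf X \<in> X" for X :: "int set"
proof -
  assume "X \<noteq> {}" "bdd_below X"
  then obtain x where "x \<in> X" "x < Inf X + 1"
    using cInf_lessD[of X "Inf X + 1"] by fastforce
  moreover from this have "Inf X \<le> x"
    using \<open>bdd_below X\<close> by (intro cInf_lower)
  ultimately have "x = Inf X" by linarith
  with \<open>x \<in> X\<close> show ?thesis by simp
qed

text \<open>On a set of integers without maximum, \<open>Sup\<close> is a definite description of a
  predicate that nothing satisfies, hence one fixed integer. The event that \<open>Sup\<close>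
  equals \<open>z\<close> is thus a countable combination of the events
  \<open>Q l u\<close>.\<close>

lemma measurable_Sup_int:
  fixes Q :: "'l \<Rightarrow> int \<Rightarrow> bool"
  assumes [measurable]: "\<And>z. Measurable.pred M (\<lambda>l. Q l z)"
  shows "(\<lambda>l. Sup {z. Q l z}) \<in> measurable M (count_space UNIV)"
proof (rule measurable_count_space_eq_countable[THEN iffD2], safe)
  fix z :: int
  have "Sup {u. Q l u} = z \<longleftrightarrow> (Q l z \<and> (\<forall>u. Q l u \<longrightarrow> u \<le> z)) \<or>
      (\<not> (\<exists>u. Q l u \<and> (\<forall>v. Q l v \<longrightarrow> v \<le> u)) \<and> (THE u :: int. False) = z)" for l
  proof (cases "\<exists>u. Q l u \<and> (\<forall>v. Q l v \<longrightarrow> v \<le> u)")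
    case True
    then obtain u where u: "Q l u" "\<And>v. Q l v \<Longrightarrow> v \<le> u" by blast
    then have "Sup {u. Q l u} = u" by (intro cSup_eq_maximum) auto
    with u show ?thesis by (auto intro: order_antisym)
  next
    case False
    then have "Sup {u. Q l u} = (THE u :: int. False)"
      unfolding Sup_int_def by (intro arg_cong[of _ _ The]) (auto simp: fun_eq_iff)
    with False show ?thesis by auto
  qed
  then have "(\<lambda>l. Sup {z. Q l z}) -` {z} \<inter> space M = {l \<in> space M.
      (Q l z \<and> (\<forall>u. Q l u \<longrightarrow> u \<le> z)) \<or>
      (\<not> (\<exists>u. Q l u \<and> (\<forall>v. Q l v \<longrightarrow> v \<le> u)) \<and> (THE u :: int. False) = z)}"
    by auto
  also have "\<dots> \<in> sets M" by measurable
  finally show "(\<lambda>l. Sup {z. Q l z}) -` {z} \<inter> space M \<in> sets M" .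
qed auto

lemma measurable_Inf_int:
  fixes Q :: "'l \<Rightarrow> int \<Rightarrow> bool"
  assumes [measurable]: "\<And>z. Measurable.pred M (\<lambda>l. Q l z)"
  shows "(\<lambda>l. Inf {z. Q l z}) \<in> measurable M (count_space UNIV)"
proof -
  have "uminus ` {z. Q l z} = {z. Q l (- z)}" for l
    by (auto simp: image_iff) (metis minus_minus)
  then have "(\<lambda>l. Inf {z. Q l z}) = (\<lambda>l. - Sup {z. Q l (- z)})"
    by (simp add: Inf_int_def)
  moreover have [measurable]: "(\<lambda>l. Sup {z. Q l (- z)}) \<in> measurable M (count_space UNIV)"
    by (rule measurable_Sup_int) measurable
  ultimately show ?thesis by simp
qed

lemma pred_regeneration [measurable]: "Measurable.pred seq_space (\<lambda>l. regeneration l z)"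
  unfolding regeneration_def by measurable

lemma measurable_regen_backward [measurable]:
  "(\<lambda>l. regen_backward l n) \<in> measurable seq_space (count_space UNIV)"
proof (induction n)
  case 0
  then show ?case unfolding regen_backward.simps by (intro measurable_Sup_int) measurable
next
  case (Suc n)
  note [measurable] = Suc.IH
  show ?case unfolding regen_backward.simps by (intro measurable_Sup_int) measurable
qed

lemma measurable_regen_forward [measurable]:
  "(\<lambda>l. regen_forward l n) \<in> measurable seq_space (count_space UNIV)"
proof (induction n)
  case 0
  show ?case unfolding regen_forward.simps by measurable
next
  case (Suc n)
  note [measurable] = Suc.IH
  show ?case unfolding regen_forward.simps by (intro measurable_Inf_int) measurable
qed

lemma measurable_regen_time [measurable]:
  "(\<lambda>l. regen_time l j) \<in> measurable seq_space (count_space UNIV)"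
  unfolding regen_time_def by measurable

lemma regeneration_shift: "regeneration (\<lambda>n. l (n + m)) z \<longleftrightarrow> regeneration l (z + m)"
  by (simp add: regeneration_def add_ac)

lemma regen_backward_in:
  assumes "\<And>z. \<exists>u<z. regeneration l u"
  shows "regeneration l (regen_backward l n)" "regen_backward l (Suc n) < regen_backward l n"
    "regen_backward l n \<le> - int n"
proof -
  have *: "Sup {z. z < u \<and> regeneration l z} \<in> {z. z < u \<and> regeneration l z}" for u
    using assms[of u] by (intro Sup_int_in) (auto intro!: bdd_aboveI[of _ u])
  have 0: "Sup {z. z \<le> 0 \<and> regeneration l z} \<in> {z. z \<le> 0 \<and> regeneration l z}"
    using assms[of 0] by (intro Sup_int_in) (auto intro!: bdd_aboveI[of _ 0] intro: less_imp_le)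
  show "regeneration l (regen_backward l n)"
    using * 0 by (cases n) auto
  show less: "regen_backward l (Suc n) < regen_backward l n" for n
    using * by auto
  show "regen_backward l n \<le> - int n"
  proof (induction n)
    case (Suc n)
    then show ?case using less[of n] by linarith
  qed (use 0 in auto)
qed

lemma regen_forward_in:
  assumes "\<And>z. \<exists>u<z. regeneration l u" "\<And>z. \<exists>u>z. regeneration l u"
  shows "regeneration l (regen_forward l n)" "regen_forward l n < regen_forward l (Suc n)"
    "int n \<le> regen_forward l (Suc n)"
proof -
  have *: "Inf {z. z > u \<and> regeneration l z} \<in> {z. z > u \<and> regeneration l z}" for u
    using assms(2)[of u] by (intro Inf_int_in) (auto intro!: bdd_belowI[of _ u])
  show reg: "regeneration l (regen_forward l n)" for n
    using * regen_backward_in(1)[OF assms(1), of 0] by (cases n) (auto simp del: regen_backward.simps)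
  show less: "regen_forward l n < regen_forward l (Suc n)" for n
    using * by auto
  show "int n \<le> regen_forward l (Suc n)"
  proof (induction n)
    case 0
    show ?case
    proof (rule ccontr)
      \<comment> \<open>A negative first forward time would be a regeneration before 0 lying above
        \<open>regen_forward l 0\<close>, the largest regeneration up to 0.\<close>
      assume "\<not> int 0 \<le> regen_forward l (Suc 0)"
      then have "regen_forward l (Suc 0) \<le> Sup {z. z \<le> 0 \<and> regeneration l z}"
        using reg[of "Suc 0"] by (intro cSup_upper) (auto intro!: bdd_aboveI[of _ 0])
      with less[of 0] show False by simp
    qed
  next
    case (Suc n)
    then show ?case using less[of "Suc n"] by linarith
  qed
qed

text \<open>By the last two bounds, the strings with indices \<open>-k\<close> to \<open>k\<close>
  cover all times from \<open>-k\<close> to \<open>k - 1\<close>, so they enclose any given block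
  once \<open>k\<close> is large.\<close>

lemma regen_time_in:
  assumes "\<And>z. \<exists>u<z. regeneration l u" "\<And>z. \<exists>u>z. regeneration l u"
  shows "regeneration l (regen_time l j)" "regen_time l j < regen_time l (j + 1)"
    "regen_time l (- int k) \<le> - int k" "int k \<le> regen_time l (int k + 1)"
proof -
  note b = regen_backward_in[OF assms(1)] and f = regen_forward_in[OF assms]
  show "regeneration l (regen_time l j)"
    using b f by (auto simp: regen_time_def)
  show "regen_time l j < regen_time l (j + 1)"
  proof (cases "0 \<le> j")
    case True
    then have "nat (j + 1) = Suc (nat j)" by linarith
    with True show ?thesis using f(2)[of "nat j"] by (auto simp: regen_time_def simp del: regen_forward.simps)
  next
    case False
    then have "nat (- j) = Suc (nat (- (j + 1)))" by linarith
    \<comment> \<open>At \<open>j = -1\<close> the two recursions meet: index 0 is read off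
      \<open>regen_forward l 0\<close>, which is \<open>regen_backward l 0\<close>.\<close>
    with False show ?thesis using b(2)[of "nat (- (j + 1))"]
      by (cases "j = -1") (auto simp: regen_time_def simp del: regen_backward.simps)
  qed
  show "regen_time l (- int k) \<le> - int k"
    using b(3)[of k] b(3)[of 0] by (auto simp: regen_time_def simp del: regen_backward.simps)
  have "nat (int k + 1) = Suc k" by simp
  then show "int k \<le> regen_time l (int k + 1)"
    using f(3)[of k] by (simp add: regen_time_def del: regen_forward.simps)
qed

section \<open>Almost sure existence of regenerations in both directions\<close>

lemma (in prob_space) indep_vars_reindex:
  assumes inj: "inj f" and indep: "indep_vars (\<lambda>_. N) X UNIV"
  shows "indep_vars (\<lambda>_. N) (\<lambda>i. X (f i)) UNIV"
  unfolding indep_vars_def2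
proof (intro conjI ballI)
  show "indep_sets (\<lambda>i. {X (f i) -` A \<inter> space M |A. A \<in> sets N}) UNIV"
  proof (rule indep_setsI)
    fix A J assume J: "J \<noteq> {}" "finite J"
      and A: "\<forall>j\<in>J. A j \<in> {X (f j) -` A \<inter> space M |A. A \<in> sets N}"
    have inv: "inv f (f j) = j" for j using inj by simp
    have "prob (\<Inter>i\<in>f ` J. A (inv f i)) = (\<Prod>i\<in>f ` J. prob (A (inv f i)))"
      using indep J A by (intro indep_setsD[where F = "\<lambda>i. {X i -` A \<inter> space M |A. A \<in> sets N}" and I = UNIV])
        (auto simp: indep_vars_def2 inv)
    then show "prob (\<Inter>j\<in>J. A j) = (\<Prod>j\<in>J. prob (A j))"
      using inj by (simp add: inv prod.reindex inj_on_def inj_def image_image)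
  qed (use indep in \<open>auto simp: indep_vars_def2 intro: measurable_sets\<close>)
qed (use indep in \<open>auto simp: indep_vars_def2\<close>)

text \<open>The partial sums of \<open>q\<close> are the distribution function of a lag, so the
  infinite product is the probability that a given time is a regeneration.\<close>

locale regenerative_process = prob_space C
  for C :: "'c measure" and q :: "nat \<Rightarrow> real" and P :: "'s::finite list \<Rightarrow> 's pmf"
    and L :: "int \<Rightarrow> 'c \<Rightarrow> nat" and Z :: "int \<Rightarrow> 'c \<Rightarrow> 's" +
  assumes construction: "regenerative_construction C q P L Z"
    and product: "convergent_prod (\<lambda>m. \<Sum>k\<le>m. q k)" "0 < (\<Prod>m. \<Sum>k\<le>m. q k)"
begin

lemma indep_L: "indep_vars (\<lambda>_. count_space UNIV) L UNIV"
  and prob_L: "prob {\<omega> \<in> space C. L n \<omega> = k} = q k"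
  and measurable_Z [measurable]: "Z n \<in> measurable C (count_space UNIV)"
  using construction by (auto simp: regenerative_construction_def)

lemma measurable_L [measurable]: "L n \<in> measurable C (count_space UNIV)"
  using indep_L by (auto simp: indep_vars_def2)

lemma measurable_L_seq [measurable]: "(\<lambda>\<omega> n. L n \<omega>) \<in> measurable C seq_space"
  by (rule measurable_PiM_single') (auto simp: space_PiM)

lemma measurable_Z_seq [measurable]: "(\<lambda>\<omega> n. Z n \<omega>) \<in> measurable C seq_space"
  by (rule measurable_PiM_single') (auto simp: space_PiM)

lemma distr_L_shift: "distr C seq_space (\<lambda>\<omega> n. L (n + m) \<omega>) = distr C seq_space (\<lambda>\<omega> n. L n \<omega>)"
proof -
  have "distr C (count_space UNIV) (L (n + m)) = distr C (count_space UNIV) (L n)" for n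
    by (rule measure_eqI_countable[where A = UNIV])
       (auto simp: emeasure_distr vimage_def Int_def conj_commute emeasure_eq_measure prob_L)
  moreover have "indep_vars (\<lambda>_. count_space UNIV) (\<lambda>n. L (n + m)) UNIV"
    by (rule indep_vars_reindex[OF _ indep_L]) (simp add: inj_def)
  ultimately show ?thesis
    using indep_L by (simp add: indep_vars_iff_distr_eq_PiM restrict_UNIV)
qed

lemma prob_L_le: "prob {\<omega> \<in> space C. L n \<omega> \<le> m} = (\<Sum>k\<le>m. q k)"
proof -
  have "{\<omega> \<in> space C. L n \<omega> \<le> m} = (\<Union>k\<in>{..m}. {\<omega> \<in> space C. L n \<omega> = k})" by auto
  also have "prob \<dots> = (\<Sum>k\<le>m. prob {\<omega> \<in> space C. L n \<omega> = k})"
    by (rule finite_measure_finite_Union) (auto simp: disjoint_family_on_def)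
  finally show ?thesis by (simp add: prob_L)
qed

text \<open>Each factor is the probability that a lag is at most \<open>m\<close>, so the partial
  products decrease.\<close>

lemma prodinf_le: "(\<Prod>m. \<Sum>k\<le>m. q k) \<le> (\<Prod>m\<le>n. \<Sum>k\<le>m. q k)"
proof (rule decseq_ge[OF _ convergent_prod_LIMSEQ[OF product(1)]])
  have "(\<Prod>m\<le>n. \<Sum>k\<le>m. q k) * (\<Sum>k\<le>Suc n. q k) \<le> (\<Prod>m\<le>n. \<Sum>k\<le>m. q k)" for n
    using prob_L_le[of 0, symmetric] by (intro mult_right_le_one_le prod_nonneg) (simp_all del: sum.atMost_Suc)
  then show "decseq (\<lambda>n. \<Prod>m\<le>n. \<Sum>k\<le>m. q k)"
    unfolding decseq_Suc_iff prod.atMost_Suc by blast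
qed

text \<open>By independence, the first \<open>n + 1\<close> conditions of a regeneration hold
  together with the probability given by the partial product; continuity from above passes to all of
  them.\<close>

lemma prob_regeneration_ge:
  "(\<Prod>m. \<Sum>k\<le>m. q k) \<le> prob {\<omega> \<in> space C. regeneration (\<lambda>n. L n \<omega>) z}"
proof -
  define E where "E n = {\<omega> \<in> space C. \<forall>m\<le>n. L (z + int m) \<omega> \<le> m}" for n
  have "prob (E n) = (\<Prod>m\<le>n. \<Sum>k\<le>m. q k)" for n
  proof -
    have inj: "inj_on (\<lambda>m. z + int m) {..n}" by (auto simp: inj_on_def)
    have "E n = (\<Inter>i\<in>(\<lambda>m. z + int m) ` {..n}. L i -` {..nat (i - z)} \<inter> space C)"
      by (auto simp: E_def)
    also have "prob \<dots> = (\<Prod>i\<in>(\<lambda>m. z + int m) ` {..n}. prob (L i -` {..nat (i - z)} \<inter> space C))"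
      by (rule indep_varsD[OF indep_L]) auto
    also have "\<dots> = (\<Prod>m\<le>n. prob {\<omega> \<in> space C. L (z + int m) \<omega> \<le> m})"
      by (subst prod.reindex[OF inj]) (auto intro!: prod.cong arg_cong[of _ _ prob])
    finally show ?thesis by (simp add: prob_L_le)
  qed
  then have "(\<Prod>m. \<Sum>k\<le>m. q k) \<le> prob (E n)" for n using prodinf_le by simp
  moreover have "(\<lambda>n. prob (E n)) \<longlonglongrightarrow> prob (\<Inter>n. E n)"
    by (rule finite_Lim_measure_decseq) (auto simp: E_def decseq_def)
  moreover have "(\<Inter>n. E n) = {\<omega> \<in> space C. regeneration (\<lambda>n. L n \<omega>) z}"
    by (auto simp: E_def regeneration_def)
  ultimately show ?thesis by (metis LIMSEQ_le_const)
qed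

text \<open>A regeneration at \<open>z\<close> depends only on the lags from \<open>z\<close> on, so
  infinitely many regenerations at nonnegative times form a tail event. It is a decreasing limit of
  events whose probabilities are at least the positive product, so the 0-1 law makes it almost
  sure.\<close>

lemma AE_regeneration_right: "AE \<omega> in C. \<forall>z. \<exists>u>z. regeneration (\<lambda>n. L n \<omega>) u"
proof -
  define A where "A n = sigma_sets (space C) {L (int n) -` S \<inter> space C | S. S \<in> sets (count_space UNIV)}" for n
  define E where "E = {\<omega> \<in> space C. \<forall>n. \<exists>m. regeneration (\<lambda>n. L n \<omega>) (int (n + m))}"
  have "indep_vars (\<lambda>_. count_space UNIV) (\<lambda>n. L (int n)) UNIV"
    by (rule indep_vars_reindex[OF _ indep_L]) (simp add: inj_def)
  then have indep: "indep_sets A UNIV" by (simp add: indep_vars_def A_def[abs_def])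
  have "E \<in> tail_events A"
    unfolding tail_events_def
  proof
    fix j :: nat
    define D where "D = sigma (space C) (\<Union> (A ` {j..}))"
    have sub: "\<Union> (A ` {j..}) \<subseteq> Pow (space C)"
      by (auto simp: A_def dest: sigma_sets_into_sp[rotated])
    have sets_D: "sets D = sigma_sets (space C) (\<Union> (A ` {j..}))" and space_D [simp]: "space D = space C"
      using sub by (simp_all add: D_def)
    have [measurable]: "L (int (j + n)) \<in> measurable D (count_space UNIV)" for n
    proof (rule measurableI)
      fix S :: "nat set"
      have "L (int (j + n)) -` S \<inter> space C \<in> A (j + n)"
        unfolding A_def by (rule sigma_sets.Basic) auto
      then show "L (int (j + n)) -` S \<inter> space D \<in> sets D"
        by (auto simp: sets_D intro!: sigma_sets.Basic bexI[of _ "j + n"])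
    qed simp
    \<comment> \<open>Dropping the first \<open>j\<close> candidate times does not change
      \<open>E\<close>, and only lags with index at least \<open>j\<close> are left.\<close>
    have "E = {\<omega> \<in> space D. \<forall>n. \<exists>m. \<forall>i. L (int (j + (n + m + i))) \<omega> \<le> i}"
    proof (safe)
      fix \<omega> n assume "\<omega> \<in> E"
      then have "\<forall>n. \<exists>m. regeneration (\<lambda>n. L n \<omega>) (int (n + m))" by (simp add: E_def)
      from spec[OF this, of "j + n"]
      obtain m where reg: "regeneration (\<lambda>n. L n \<omega>) (int (j + n + m))" ..
      have "L (int (j + (n + m + i))) \<omega> \<le> i" for i
        using reg[unfolded regeneration_def, rule_format, of i] by (simp add: add.assoc)
      then show "\<exists>m. \<forall>i. L (int (j + (n + m + i))) \<omega> \<le> i"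
        by (intro exI[of _ m] allI)
    next
      fix \<omega> assume "\<omega> \<in> space D" and r: "\<forall>n. \<exists>m. \<forall>i. L (int (j + (n + m + i))) \<omega> \<le> i"
      have "\<exists>m. regeneration (\<lambda>n. L n \<omega>) (int (n + m))" for n
      proof -
        from r obtain m where "\<forall>i. L (int (j + (n + m + i))) \<omega> \<le> i" by blast
        then have "regeneration (\<lambda>n. L n \<omega>) (int (n + (j + m)))"
          by (auto simp: regeneration_def add_ac)
        then show ?thesis ..
      qed
      with \<open>\<omega> \<in> space D\<close> show "\<omega> \<in> E" by (simp add: E_def)
    qed (simp add: E_def)
    also have "\<dots> \<in> sets D" by measurable
    finally show "E \<in> sigma_sets (space C) (\<Union> (A ` {j..}))" by (simp add: sets_D)
  qed
  moreover have "sigma_algebra (space C) (A n)" for n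
    unfolding A_def by (rule sigma_algebra_sigma_sets) auto
  ultimately have "prob E = 0 \<or> prob E = 1"
    using indep by (intro kolmogorov_0_1_law[of A]) auto
  moreover have "(\<Prod>m. \<Sum>k\<le>m. q k) \<le> prob E" (is "?c \<le> _")
  proof -
    define U where "U n = {\<omega> \<in> space C. \<exists>m. regeneration (\<lambda>n. L n \<omega>) (int (n + m))}" for n
    have c_le_U: "?c \<le> prob (U n)" for n
    proof -
      have "prob {\<omega> \<in> space C. regeneration (\<lambda>n. L n \<omega>) (int n)} \<le> prob (U n)"
        by (rule finite_measure_mono) (auto simp: U_def intro: exI[of _ 0])
      then show ?thesis using prob_regeneration_ge[of "int n"] by linarith
    qed
    have "decseq U"
      unfolding decseq_Suc_iff
    proof (intro allI subsetI)
      fix n \<omega> assume "\<omega> \<in> U (Suc n)"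
      then obtain m where "\<omega> \<in> space C" "regeneration (\<lambda>n. L n \<omega>) (int (Suc n + m))"
        by (auto simp only: U_def mem_Collect_eq)
      then show "\<omega> \<in> U n"
        unfolding U_def by (intro CollectI conjI exI[of _ "Suc m"]) (simp_all only: add_Suc_shift)
    qed
    moreover have "U n \<in> events" for n unfolding U_def by measurable
    ultimately have "(\<lambda>n. prob (U n)) \<longlonglongrightarrow> prob (\<Inter>n. U n)"
      by (intro finite_Lim_measure_decseq) auto
    moreover have "(\<Inter>n. U n) = E" by (auto simp: U_def E_def)
    ultimately show ?thesis using c_le_U by (metis LIMSEQ_le_const)
  qed
  ultimately have "prob E = 1" using product(2) by linarith
  then have "AE \<omega> in C. \<omega> \<in> E" by (simp add: AE_prob_1)
  then show ?thesis
  proof (eventually_elim, intro allI)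
    fix \<omega> z assume "\<omega> \<in> E"
    then have "\<forall>n. \<exists>m. regeneration (\<lambda>n. L n \<omega>) (int (n + m))" by (simp add: E_def)
    from spec[OF this, of "nat (z + 1)"] obtain m where "regeneration (\<lambda>n. L n \<omega>) (int (nat (z + 1) + m))" ..
    then show "\<exists>u>z. regeneration (\<lambda>n. L n \<omega>) u" by (intro exI[of _ "int (nat (z + 1) + m)"]) auto
  qed
qed

text \<open>Regenerations far in the past also involve all later lags, so shift invariance takes the
  place of the 0-1 law: having none before \<open>z\<close> is at most as likely as having none in
  \<open>{0..n}\<close>, and this probability tends to 0 by
  \<open>AE_regeneration_right\<close>.\<close>

lemma AE_regeneration_left: "AE \<omega> in C. \<forall>z. \<exists>u<z. regeneration (\<lambda>n. L n \<omega>) u"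
proof (rule AE_all_countable[THEN iffD2], rule allI)
  fix z :: int
  define V where "V n = {\<omega> \<in> space C. \<forall>m\<le>n. \<not> regeneration (\<lambda>n. L n \<omega>) (int m)}" for n
  define W where "W = {\<omega> \<in> space C. \<not> (\<exists>u<z. regeneration (\<lambda>n. L n \<omega>) u)}"
  have [measurable]: "W \<in> events" unfolding W_def by measurable
  have le: "prob W \<le> prob (V n)" for n
  proof -
    define B where "B = {l \<in> space seq_space. \<forall>m\<le>n. \<not> regeneration l (int m)}"
    have [measurable]: "B \<in> sets seq_space" unfolding B_def by measurable
    \<comment> \<open>The shift by \<open>s\<close> carries the times from 0 to \<open>n\<close> to
      the \<open>n + 1\<close> times ending at \<open>z - 1\<close>.\<close>
    define s where "s = z - 1 - int n"
    have [measurable]: "(\<lambda>\<omega> n. L (n + s) \<omega>) \<in> measurable C seq_space"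
      by (rule measurable_PiM_single') (auto simp: space_PiM)
    have "prob W \<le> prob ((\<lambda>\<omega> n. L (n + s) \<omega>) -` B \<inter> space C)"
      by (rule finite_measure_mono) (auto simp: W_def B_def regeneration_shift[where l = "\<lambda>n. L n _"] space_PiM s_def)
    also have "\<dots> = measure (distr C seq_space (\<lambda>\<omega> n. L (n + s) \<omega>)) B"
      by (simp add: measure_distr)
    also have "\<dots> = prob ((\<lambda>\<omega> n. L n \<omega>) -` B \<inter> space C)"
      by (simp add: distr_L_shift measure_distr)
    also have "(\<lambda>\<omega> n. L n \<omega>) -` B \<inter> space C = V n"
      by (auto simp: B_def V_def space_PiM)
    finally show ?thesis .
  qed
  have "(\<lambda>n. prob (V n)) \<longlonglongrightarrow> prob (\<Inter>n. V n)"
    by (rule finite_Lim_measure_decseq) (auto simp: V_def decseq_def)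
  moreover have "AE \<omega> in C. \<omega> \<notin> (\<Inter>n. V n)"
    using AE_regeneration_right
  proof eventually_elim
    case (elim \<omega>)
    then obtain u where "u > 0" "regeneration (\<lambda>n. L n \<omega>) u" by blast
    then have "\<omega> \<notin> V (nat u)" by (auto simp: V_def)
    then show ?case by blast
  qed
  then have "prob (\<Inter>n. V n) = 0"
    by (intro prob_eq_0[THEN iffD2]) (auto simp: V_def)
  ultimately have "prob W \<le> 0"
    using le by (intro LIMSEQ_le_const[where X = "\<lambda>n. prob (V n)"]) auto
  then have "prob W = 0" by (simp add: measure_le_0_iff)
  then have "AE \<omega> in C. \<omega> \<notin> W" by (simp add: prob_eq_0)
  then show "AE \<omega> in C. \<exists>u<z. regeneration (\<lambda>n. L n \<omega>) u"
    using AE_space by eventually_elim (simp add: W_def)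
qed

end

section \<open>Conditional law of a block given the lags\<close>

text \<open>The blocks tile the window from \<open>t 0\<close> to \<open>t r\<close>. An event about
  separate strings thus becomes one about their concatenation.\<close>

lemma recent_blocks_eq_iff:
  fixes t :: "nat \<Rightarrow> int"
  assumes "\<And>i. i < r \<Longrightarrow> t i \<le> t (Suc i)"
  shows "t 0 \<le> t r \<and>
    ((\<forall>i<r. recent (nat (t (Suc i) - t i)) (past_at x (t (Suc i)))
          = recent (nat (t (Suc i) - t i)) (past_at y (t (Suc i))))
      \<longleftrightarrow> recent (nat (t r - t 0)) (past_at x (t r)) = recent (nat (t r - t 0)) (past_at y (t r)))"
  using assms
proof (induction r)
  case (Suc r)
  then have le: "t 0 \<le> t r" "t r \<le> t (Suc r)" by auto
  then have "nat (t (Suc r) - t 0) = nat (t (Suc r) - t r) + nat (t r - t 0)" by linarith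
  then have "recent (nat (t (Suc r) - t 0)) (past_at z (t (Suc r)))
     = recent (nat (t (Suc r) - t r)) (past_at z (t (Suc r))) @ recent (nat (t r - t 0)) (past_at z (t r))" for z :: "int \<Rightarrow> 'a"
    using le by (simp add: recent_past_at_add)
  then show ?case
    using Suc le by (auto simp: less_Suc_eq intro: order_trans)
qed simp

lemma exists_sequence_recent:
  obtains x where "recent (length h) (past_at x b) = h"
proof
  show "recent (length h) (past_at (\<lambda>i. h ! nat (b - 1 - i)) b) = h"
    by (rule nth_equalityI) (auto simp: nth_recent past_at_def)
qed

context regenerative_process
begin

abbreviation lags :: "'c \<Rightarrow> int \<Rightarrow> nat" where
  "lags \<omega> \<equiv> \<lambda>n. L n \<omega>"

abbreviation path :: "'c \<Rightarrow> int \<Rightarrow> 's" where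
  "path \<omega> \<equiv> \<lambda>n. Z n \<omega>"

definition lag_algebra :: "'c measure" where
  "lag_algebra = vimage_algebra (space C) lags seq_space"

lemma space_lag_algebra [simp]: "space lag_algebra = space C"
  by (simp add: lag_algebra_def)

lemma measurable_lags [measurable]: "lags \<in> measurable lag_algebra seq_space"
  unfolding lag_algebra_def by (rule measurable_vimage_algebra1) (auto simp: space_PiM)

lemma subalgebra_lag_algebra: "subalgebra C lag_algebra"
  unfolding subalgebra_def lag_algebra_def
  by (auto simp: sets_vimage_algebra2 space_PiM intro: measurable_sets[OF measurable_L_seq])

sublocale lag: finite_measure_subalgebra C lag_algebra
  by unfold_locales (rule subalgebra_lag_algebra)

lemma measurable_recent_path [measurable]:
  "(\<lambda>\<omega>. recent k (past_at (path \<omega>) b)) \<in> measurable C (count_space UNIV)"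
  by measurable

text \<open>The end points are random but take countably many values; fixing them one after the
  other leaves blocks at fixed times.\<close>

lemma measurable_regen_string [measurable]:
  "(\<lambda>\<omega>. regen_string (lags \<omega>) (path \<omega>) j) \<in> measurable C (count_space UNIV)"
proof -
  have "(\<lambda>\<omega>. recent (nat (v - regen_time (lags \<omega>) j)) (past_at (path \<omega>) v)) \<in> measurable C (count_space UNIV)" for v
    by (rule measurable_compose_countable[where f = "\<lambda>u \<omega>. recent (nat (v - u)) (past_at (path \<omega>) v)"]) measurable
  then show ?thesis
    unfolding regen_string_def
    by (rule measurable_compose_countable[where f = "\<lambda>v \<omega>. recent (nat (v - regen_time (lags \<omega>) j)) (past_at (path \<omega>) v)"]) measurable
qed

lemma AE_regen_time:
  "AE \<omega> in C. \<forall>j k. regeneration (lags \<omega>) (regen_time (lags \<omega>) j)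
     \<and> regen_time (lags \<omega>) j < regen_time (lags \<omega>) (j + 1)
     \<and> regen_time (lags \<omega>) (- int k) \<le> - int k \<and> int k \<le> regen_time (lags \<omega>) (int k + 1)"
  using AE_regeneration_left AE_regeneration_right
  by eventually_elim (use regen_time_in in blast)

lemma cond_exp_regen_strings:
  assumes "finite J"
  shows "AE \<omega> in C. real_cond_exp C lag_algebra
       (indicator {\<omega> \<in> space C. \<forall>j\<in>J. regen_string (lags \<omega>) (path \<omega>) j = z j}) \<omega>
     = (\<Prod>j\<in>J. pmf (string_law P (lags \<omega>) (regen_time (lags \<omega>) j) (regen_time (lags \<omega>) (j + 1))) (z j))"
  using construction assms unfolding regenerative_construction_def lag_algebra_def by blast

text \<open>The event that the regeneration times are the \<open>t i\<close> belongs to the lag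
  algebra, so it can be pulled out of the conditional expectation. On it, the block event splits
  over the possible concatenations \<open>h\<close> of the enclosing strings, and the product of
  string laws is the law of one extension started at \<open>t 0\<close>.\<close>

lemma cond_exp_block_fixed_times:
  fixes t :: "nat \<Rightarrow> int" and S :: "'s list set" and w :: "nat \<Rightarrow> 's"
  assumes mono: "\<And>i. i < r \<Longrightarrow> t i < t (Suc i)"
    and u: "b - int N \<le> t 0" "t 0 \<le> b - int n" and v: "b \<le> t r"
  shows "AE \<omega> in C. (\<forall>i\<le>r. regen_time (lags \<omega>) (j0 + int i) = t i) \<longrightarrow>
    real_cond_exp C lag_algebra (indicator {\<omega> \<in> space C. recent n (past_at (path \<omega>) b) \<in> S}) \<omega>
      = measure (extend_past P (map (lags \<omega>) [b - int N..b - 1]) w) {v. recent n v \<in> S}"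
proof -
  \<comment> \<open>\<open>D\<close> counts the symbols from \<open>t 0\<close> to
    \<open>t r - 1\<close>, and \<open>d\<close> those from \<open>b\<close> on, which stand first
    since strings run backwards in time.\<close>
  define D where "D = nat (t r - t 0)"
  define d where "d = nat (t r - b)"
  have D: "n + d \<le> D" and b: "t r - int d = b" using u v by (auto simp: D_def d_def)
  define H where "H = {h :: 's list. length h = D \<and> take n (drop d h) \<in> S}"
  \<comment> \<open>The alphabet is finite, so conditional expectations can be added up over
    \<open>H\<close>.\<close>
  have fin: "finite H"
    by (rule finite_subset[OF _ finite_lists_length_eq[of UNIV D]]) (auto simp: H_def)
  obtain x :: "'s list \<Rightarrow> int \<Rightarrow> 's" where x: "\<And>h. recent (length h) (past_at (x h) (t r)) = h"
    using exists_sequence_recent by metis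
  \<comment> \<open>\<open>z h j\<close> is the string with index \<open>j\<close> when the
    concatenation is \<open>h\<close>: the sequence \<open>x h\<close> spells \<open>h\<close> just
    before \<open>t r\<close> and is cut at the times \<open>t i\<close>.\<close>
  define z where "z h j = recent (nat (t (Suc (nat (j - j0))) - t (nat (j - j0)))) (past_at (x h) (t (Suc (nat (j - j0)))))" for h j
  define J where "J = (\<lambda>i. j0 + int i) ` {..<r}"
  define A where "A = {\<omega> \<in> space C. \<forall>i\<le>r. regen_time (lags \<omega>) (j0 + int i) = t i}"
  define G where "G h = {\<omega> \<in> space C. \<forall>j\<in>J. regen_string (lags \<omega>) (path \<omega>) j = z h j}" for h
  define B where "B = {\<omega> \<in> space C. recent n (past_at (path \<omega>) b) \<in> S}"
  have [measurable]: "A \<in> sets lag_algebra"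
    unfolding A_def space_lag_algebra[symmetric] by measurable
  then have A[measurable]: "A \<in> events"
    using subalgebra_lag_algebra by (auto simp: subalgebra_def)
  have "finite J" by (simp add: J_def)
  have [measurable]: "G h \<in> events" for h
    unfolding G_def using \<open>finite J\<close> by measurable
  have [measurable]: "B \<in> events" unfolding B_def by measurable
  have G_iff: "\<omega> \<in> G h \<longleftrightarrow> recent D (past_at (path \<omega>) (t r)) = h"
    if "\<omega> \<in> A" "length h = D" for \<omega> h
  proof -
    have "regen_string (lags \<omega>) (path \<omega>) (j0 + int i) = recent (nat (t (Suc i) - t i)) (past_at (path \<omega>) (t (Suc i)))"
      if "i < r" for i
    proof -
      have "regen_time (lags \<omega>) (j0 + int i) = t i" "regen_time (lags \<omega>) (j0 + int (Suc i)) = t (Suc i)"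
        using \<open>\<omega> \<in> A\<close> that by (auto simp: A_def simp del: of_nat_Suc)
      then show ?thesis by (simp add: regen_string_def add_ac)
    qed
    then have "\<omega> \<in> G h \<longleftrightarrow> (\<forall>i<r. recent (nat (t (Suc i) - t i)) (past_at (path \<omega>) (t (Suc i)))
          = recent (nat (t (Suc i) - t i)) (past_at (x h) (t (Suc i))))"
      using \<open>\<omega> \<in> A\<close> by (auto simp: G_def J_def z_def A_def)
    also have "\<dots> \<longleftrightarrow> recent D (past_at (path \<omega>) (t r)) = recent D (past_at (x h) (t r))"
      unfolding D_def by (rule recent_blocks_eq_iff[THEN conjunct2]) (use mono in \<open>auto intro: less_imp_le\<close>)
    also have "recent D (past_at (x h) (t r)) = h"
      using x[of h] that by simp
    finally show ?thesis .
  qed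
  \<comment> \<open>On \<open>A\<close> the path determines exactly one concatenation, so at most
    one summand is nonzero.\<close>
  have ind: "indicator A \<omega> * indicator B \<omega> = (indicator A \<omega> * (\<Sum>h\<in>H. indicator (G h) \<omega>) :: real)" for \<omega>
  proof (cases "\<omega> \<in> A")
    case True
    let ?h = "recent D (past_at (path \<omega>) (t r))"
    have "?h = recent d (past_at (path \<omega>) (t r)) @ recent (D - d) (past_at (path \<omega>) b)"
      using D b recent_past_at_add[of d "D - d" "path \<omega>" "t r"] by simp
    then have "take n (drop d ?h) = recent n (past_at (path \<omega>) b)"
      using D by (simp add: take_recent)
    then have "\<omega> \<in> B \<longleftrightarrow> ?h \<in> H"
      using True by (auto simp: B_def H_def A_def)
    moreover have "(\<Sum>h\<in>H. indicator (G h) \<omega>) = (\<Sum>h\<in>H. if ?h = h then 1 else 0 :: real)"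
      by (intro sum.cong) (auto simp: indicator_def G_iff[OF True] H_def)
    ultimately show ?thesis using fin True by (simp add: indicator_def)
  qed simp
  have c1: "AE \<omega> in C. real_cond_exp C lag_algebra (\<lambda>\<omega>. indicator A \<omega> * indicator B \<omega>) \<omega>
      = indicator A \<omega> * real_cond_exp C lag_algebra (indicator B) \<omega>"
    by (intro lag.real_cond_exp_mult) (auto intro!: integrable_const_bound[where B = 1] simp: indicator_def)
  have c2: "AE \<omega> in C. real_cond_exp C lag_algebra (\<lambda>\<omega>. indicator A \<omega> * (\<Sum>h\<in>H. indicator (G h) \<omega>)) \<omega>
      = indicator A \<omega> * real_cond_exp C lag_algebra (\<lambda>\<omega>. \<Sum>h\<in>H. indicator (G h) \<omega>) \<omega>"
    by (intro lag.real_cond_exp_mult) (auto simp: sum_distrib_left intro!: Bochner_Integration.integrable_sum integrable_const_bound[where B = 1] simp: indicator_def)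
  have c3: "AE \<omega> in C. real_cond_exp C lag_algebra (\<lambda>\<omega>. \<Sum>h\<in>H. indicator (G h) \<omega>) \<omega>
      = (\<Sum>h\<in>H. real_cond_exp C lag_algebra (indicator (G h)) \<omega>)"
    by (intro lag.real_cond_exp_sum) (auto intro!: integrable_const_bound[where B = 1] simp: indicator_def)
  have c4: "AE \<omega> in C. \<forall>h\<in>H. real_cond_exp C lag_algebra (indicator (G h)) \<omega>
      = (\<Prod>j\<in>J. pmf (string_law P (lags \<omega>) (regen_time (lags \<omega>) j) (regen_time (lags \<omega>) (j + 1))) (z h j))"
    unfolding G_def using fin cond_exp_regen_strings[OF \<open>finite J\<close>] by (intro AE_finite_allI)
  show ?thesis
    using c1 c2 c3 c4 AE_regen_time AE_space
  proof eventually_elim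
    case (elim \<omega>)
    show ?case
    proof
      assume times: "\<forall>i\<le>r. regen_time (lags \<omega>) (j0 + int i) = t i"
      let ?E = "extend_string P (map (lags \<omega>) [t 0..t r - 1]) []"
      from elim(6) times have "\<omega> \<in> A" by (simp add: A_def)
      have T: "regen_time (lags \<omega>) (j0 + int i) = t i" if "i \<le> r" for i
        using times that by simp
      have reg: "regeneration (lags \<omega>) (t i)" if "i \<le> r" for i
        using elim(5) T[OF that] by metis
      have pmf_h: "(\<Prod>j\<in>J. pmf (string_law P (lags \<omega>) (regen_time (lags \<omega>) j) (regen_time (lags \<omega>) (j + 1))) (z h j))
          = pmf ?E h" if "h \<in> H" for h
      proof -
        have "(\<Prod>j\<in>J. pmf (string_law P (lags \<omega>) (regen_time (lags \<omega>) j) (regen_time (lags \<omega>) (j + 1))) (z h j))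
           = (\<Prod>i<r. pmf (string_law P (lags \<omega>) (t i) (t (Suc i)))
              (recent (nat (t (Suc i) - t i)) (past_at (x h) (t (Suc i)))))"
          unfolding J_def
        proof (subst prod.reindex, simp add: inj_on_def, intro prod.cong refl)
          fix i assume "i \<in> {..<r}"
          then show "((\<lambda>j. pmf (string_law P (lags \<omega>) (regen_time (lags \<omega>) j) (regen_time (lags \<omega>) (j + 1))) (z h j)) \<circ> (\<lambda>i. j0 + int i)) i
            = pmf (string_law P (lags \<omega>) (t i) (t (Suc i))) (recent (nat (t (Suc i) - t i)) (past_at (x h) (t (Suc i))))"
            using T[of i] T[of "Suc i"] by (simp add: z_def add_ac)
        qed
        also have "\<dots> = pmf ?E (recent (nat (t r - t 0)) (past_at (x h) (t r)))"
          using prod_string_law[of r t "lags \<omega>" P "x h"] mono reg by simp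
        also have "recent (nat (t r - t 0)) (past_at (x h) (t r)) = h"
          using x[of h] that by (simp add: H_def D_def)
        finally show ?thesis .
      qed
      have split: "[t 0..t r - 1] = [t 0..b - 1] @ [b..t r - 1]"
        using upto_split1[of "t 0" b "t r - 1"] u v by (cases "b = t r") auto
      have "real_cond_exp C lag_algebra (indicator B) \<omega> = (\<Sum>h\<in>H. pmf ?E h)"
        using elim(1-4) \<open>\<omega> \<in> A\<close> pmf_h by (simp add: ind)
      also have "\<dots> = measure ?E H"
        using fin by (simp add: measure_measure_pmf_finite)
      also have "\<dots> = measure ?E {h. take n (drop d h) \<in> S}"
        using set_pmf_extend_string[of _ P "map (lags \<omega>) [t 0..t r - 1]" "[]"]
        by (intro measure_pmf.finite_measure_eq_AE) (auto simp: AE_measure_pmf_iff H_def D_def)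
      also have "\<dots> = measure (map_pmf (take n) (map_pmf (drop d) ?E)) S"
        by (simp add: measure_map_pmf vimage_def)
      \<comment> \<open>The symbols generated from \<open>b\<close> on are marginalised out. Then
        the regeneration at \<open>t 0\<close> permits an earlier start from any past.\<close>
      also have "map_pmf (drop d) ?E = extend_string P (map (lags \<omega>) [t 0..b - 1]) []"
        using map_drop_extend_string[of "map (lags \<omega>) [b..t r - 1]" P "map (lags \<omega>) [t 0..b - 1]" "[]"]
        by (simp add: split d_def)
      also have "map_pmf (take n) \<dots> = map_pmf (recent n) (extend_past P (map (lags \<omega>) [b - int N..b - 1]) w)"
        using reg[of 0] u by (intro map_recent_extend_past_regeneration[symmetric]) auto
      finally show "real_cond_exp C lag_algebra (indicator {\<omega> \<in> space C. recent n (past_at (path \<omega>) b) \<in> S}) \<omega>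
        = measure (extend_past P (map (lags \<omega>) [b - int N..b - 1]) w) {v. recent n v \<in> S}"
        by (simp add: B_def vimage_def)
    qed
  qed
qed

text \<open>The regeneration times around the block have countably many joint values. The statement
  for fixed times holds outside a null set for each of them, hence for all at once and so for the
  actual times.\<close>

lemma cond_exp_block:
  fixes S :: "'s list set" and w :: "nat \<Rightarrow> 's"
  assumes K: "b \<le> int K" "int n \<le> b + int K"
  shows "AE \<omega> in C. b - int N \<le> regen_time (lags \<omega>) (- int K) \<longrightarrow>
    real_cond_exp C lag_algebra (indicator {\<omega> \<in> space C. recent n (past_at (path \<omega>) b) \<in> S}) \<omega>
      = measure (extend_past P (map (lags \<omega>) [b - int N..b - 1]) w) {v. recent n v \<in> S}"
proof -
  \<comment> \<open>The times with indices \<open>-K\<close> to \<open>K + 1\<close> bound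
    \<open>r\<close> strings. The first of them is at most \<open>-K\<close>, hence at most
    \<open>b - int n\<close>, and the last is at least \<open>K\<close>, hence at least
    \<open>b\<close>.\<close>
  define r where "r = 2 * K + 1"
  define T where "T \<omega> i = regen_time (lags \<omega>) (- int K + int i)" for \<omega> i
  define Q where "Q \<omega> \<longleftrightarrow>
    real_cond_exp C lag_algebra (indicator {\<omega> \<in> space C. recent n (past_at (path \<omega>) b) \<in> S}) \<omega>
      = measure (extend_past P (map (lags \<omega>) [b - int N..b - 1]) w) {v. recent n v \<in> S}" for \<omega>
  \<comment> \<open>Vectors of times are coded as integer lists, which form a countable type. If a
    list violates one of the order conditions, the claim is vacuous.\<close>
  have "AE \<omega> in C. (\<forall>i<r. \<tau> ! i < \<tau> ! Suc i) \<longrightarrow> b - int N \<le> \<tau> ! 0 \<longrightarrow> \<tau> ! 0 \<le> b - int n \<longrightarrow> b \<le> \<tau> ! r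
       \<longrightarrow> (\<forall>i\<le>r. T \<omega> i = \<tau> ! i) \<longrightarrow> Q \<omega>" for \<tau> :: "int list"
    using cond_exp_block_fixed_times[of r "(!) \<tau>" b N n "- int K" S w]
    unfolding Q_def T_def
    by (cases "(\<forall>i<r. \<tau> ! i < \<tau> ! Suc i) \<and> b - int N \<le> \<tau> ! 0 \<and> \<tau> ! 0 \<le> b - int n \<and> b \<le> \<tau> ! r") auto
  then have "AE \<omega> in C. \<forall>\<tau>. (\<forall>i<r. \<tau> ! i < \<tau> ! Suc i) \<longrightarrow> b - int N \<le> \<tau> ! 0 \<longrightarrow> \<tau> ! 0 \<le> b - int n \<longrightarrow> b \<le> \<tau> ! r
       \<longrightarrow> (\<forall>i\<le>r. T \<omega> i = \<tau> ! i) \<longrightarrow> Q \<omega>"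
    by (subst AE_all_countable) blast
  then show ?thesis
    using AE_regen_time unfolding Q_def[symmetric]
  proof eventually_elim
    case (elim \<omega>)
    show ?case
    proof
      assume N: "b - int N \<le> regen_time (lags \<omega>) (- int K)"
      define \<tau> where "\<tau> = map (T \<omega>) [0..<Suc r]"
      have \<tau>: "\<tau> ! i = T \<omega> i" if "i \<le> r" for i
        using that by (simp add: \<tau>_def nth_map_upt del: upt_Suc)
      have "T \<omega> i < T \<omega> (Suc i)" for i
        using elim(2)[rule_format, of "- int K + int i"] by (simp add: T_def add_ac)
      moreover have "T \<omega> 0 \<le> b - int n"
        using elim(2)[rule_format, of 0 K] K by (simp add: T_def)
      moreover have "b \<le> T \<omega> r"
        using elim(2)[rule_format, of 0 K] K by (simp add: T_def r_def add_ac)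
      ultimately show "Q \<omega>"
        using elim(1)[rule_format, of \<tau>] N by (auto simp: \<tau> T_def)
    qed
  qed
qed

end

section \<open>Approximation by runs of the mixture kernel\<close>

lemma pmf_replicate_pmf_Cons:
  "pmf (replicate_pmf (Suc n) p) (x # xs) = pmf p x * pmf (replicate_pmf n p) xs"
proof -
  have "pmf (bind_pmf (replicate_pmf n p) (\<lambda>ys. return_pmf (y # ys))) (x # xs)
      = pmf (replicate_pmf n p) xs * indicator {x} y" for y
  proof -
    have "bind_pmf (replicate_pmf n p) (\<lambda>ys. return_pmf (y # ys)) = map_pmf ((#) y) (replicate_pmf n p)"
      by (simp add: map_pmf_def)
    moreover have "pmf (map_pmf ((#) x) (replicate_pmf n p)) (x # xs) = pmf (replicate_pmf n p) xs"
      by (rule pmf_map_inj') (simp add: inj_def)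
    moreover have "pmf (map_pmf ((#) y) (replicate_pmf n p)) (x # xs) = 0" if "y \<noteq> x"
      using that by (auto simp: pmf_eq_0_set_pmf)
    ultimately show ?thesis by (auto simp: indicator_def)
  qed
  then show ?thesis
    by (simp add: pmf_bind measure_pmf_single)
qed

lemma pmf_replicate_pmf: "pmf (replicate_pmf (length xs) p) xs = (\<Prod>i<length xs. pmf p (xs ! i))"
  by (induction xs)
     (simp_all add: pmf_replicate_pmf_Cons lessThan_Suc_eq_insert_0 prod.reindex del: replicate_pmf.simps(2))

lemma measure_bind_pmf:
  "measure (bind_pmf p f) A = (\<integral>x. measure (f x) A \<partial>p)"
proof -
  have "emeasure (bind_pmf p f) A = (\<integral>\<^sup>+x. ennreal (measure (f x) A) \<partial>p)"
    unfolding emeasure_bind_pmf by (simp add: measure_pmf.emeasure_eq_measure)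
  then show ?thesis
    unfolding measure_def[of "measure_pmf (bind_pmf p f)"] by (subst integral_eq_nn_integral) auto
qed

context regenerative_process
begin

section \<open>Averaging over the lags\<close>

definition lag_pmf :: "nat pmf" where
  "lag_pmf = embed_pmf q"

text \<open>The events that \<open>L 0\<close> equals \<open>k\<close> partition the space, so
  \<open>q\<close> sums to one.\<close>

lemma pmf_lag_pmf: "pmf lag_pmf k = q k"
  unfolding lag_pmf_def
proof (rule pmf_embed_pmf)
  show nonneg: "0 \<le> q k" for k
    using prob_L[of 0 k] measure_nonneg[of C] by metis
  have "(\<integral>\<^sup>+k. ennreal (q k) \<partial>count_space UNIV) = (\<Sum>k. emeasure C {\<omega> \<in> space C. L 0 \<omega> = k})"
    by (simp add: nn_integral_count_space_nat emeasure_eq_measure prob_L)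
  also have "\<dots> = emeasure C (\<Union>k. {\<omega> \<in> space C. L 0 \<omega> = k})"
    by (rule suminf_emeasure) (auto simp: disjoint_family_on_def)
  also have "(\<Union>k. {\<omega> \<in> space C. L 0 \<omega> = k}) = space C" by auto
  finally show "(\<integral>\<^sup>+k. ennreal (q k) \<partial>count_space UNIV) = 1"
    by (simp add: emeasure_space_1)
qed

lemma measurable_map_lags [measurable]:
  "(\<lambda>\<omega>. map (lags \<omega>) is) \<in> measurable lag_algebra (count_space UNIV)"
proof (induction "is")
  case (Cons i js)
  note [measurable] = Cons.IH
  have "(\<lambda>\<omega>. lags \<omega> i # map (lags \<omega>) js) \<in> measurable lag_algebra (count_space UNIV)"
    by measurable
  then show ?case by simp
qed simp

lemma measurable_map_lags' [measurable]:
  "(\<lambda>\<omega>. map (lags \<omega>) is) \<in> measurable C (count_space UNIV)"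
  by (rule measurable_from_subalg[OF subalgebra_lag_algebra measurable_map_lags])

lemma distr_map_lags:
  "distr C (count_space UNIV) (\<lambda>\<omega>. map (lags \<omega>) [b - int N..b - 1]) = measure_pmf (replicate_pmf N lag_pmf)"
proof (rule measure_eqI_countable[where A = UNIV])
  fix ks :: "nat list"
  have "prob {\<omega> \<in> space C. map (lags \<omega>) [b - int N..b - 1] = ks} = pmf (replicate_pmf N lag_pmf) ks"
  proof (cases "length ks = N")
    case False
    then have "{\<omega> \<in> space C. map (lags \<omega>) [b - int N..b - 1] = ks} = {}" by auto
    moreover have "pmf (replicate_pmf N lag_pmf) ks = 0"
      using False by (simp add: pmf_eq_0_set_pmf set_replicate_pmf)
    ultimately show ?thesis by (simp only: measure_empty)
  next
    case True
    define J where "J = (\<lambda>i. b - int N + int i) ` {..<N}"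
    have inj: "inj_on (\<lambda>i. b - int N + int i) {..<N}" by (auto simp: inj_on_def)
    have "prob {\<omega> \<in> space C. map (lags \<omega>) [b - int N..b - 1] = ks}
      = (\<Prod>i<N. prob {\<omega> \<in> space C. L (b - int N + int i) \<omega> = ks ! i})"
    \<comment> \<open>The product formula for independent variables is applied to a nonempty index
      set.\<close>
    proof (cases "N = 0")
      case True
      with \<open>length ks = N\<close> show ?thesis by (simp add: prob_space)
    next
      case False
      have "{\<omega> \<in> space C. map (lags \<omega>) [b - int N..b - 1] = ks}
          = (\<Inter>j\<in>J. L j -` {ks ! nat (j - (b - int N))} \<inter> space C)"
        using True False by (auto simp: J_def list_eq_iff_nth_eq nth_upto)
      also have "prob \<dots> = (\<Prod>j\<in>J. prob (L j -` {ks ! nat (j - (b - int N))} \<inter> space C))"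
        using False by (intro indep_varsD[OF indep_L]) (auto simp: J_def)
      also have "\<dots> = (\<Prod>i<N. prob {\<omega> \<in> space C. L (b - int N + int i) \<omega> = ks ! i})"
        unfolding J_def by (subst prod.reindex[OF inj]) (auto intro!: prod.cong arg_cong[of _ _ prob])
      finally show ?thesis .
    qed
    then show ?thesis
      using pmf_replicate_pmf[of ks lag_pmf] True by (simp add: prob_L pmf_lag_pmf)
  qed
  then show "emeasure (distr C (count_space UNIV) (\<lambda>\<omega>. map (lags \<omega>) [b - int N..b - 1])) {ks}
      = emeasure (measure_pmf (replicate_pmf N lag_pmf)) {ks}"
    by (simp add: emeasure_distr emeasure_eq_measure emeasure_pmf_single vimage_def Int_def conj_commute)
qed auto

definition transition :: "(nat \<Rightarrow> 's) \<Rightarrow> 's pmf" where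
  "transition w = bind_pmf lag_pmf (\<lambda>k. P (recent k w))"

text \<open>The \<open>N\<close> lags before \<open>b\<close> have the law of \<open>N\<close>
  independent draws whatever \<open>b\<close> is. The result does not depend on \<open>b\<close>,
  which is the source of stationarity.\<close>

lemma expectation_extend_past:
  "(\<integral>\<omega>. measure (extend_past P (map (lags \<omega>) [b - int N..b - 1]) w) A \<partial>C) = measure (run transition N w) A"
proof -
  have "(\<integral>\<omega>. measure (extend_past P (map (lags \<omega>) [b - int N..b - 1]) w) A \<partial>C)
    = (\<integral>ks. measure (extend_past P ks w) A \<partial>distr C (count_space UNIV) (\<lambda>\<omega>. map (lags \<omega>) [b - int N..b - 1]))"
    by (subst integral_distr) auto
  also have "\<dots> = measure (bind_pmf (replicate_pmf N lag_pmf) (\<lambda>ks. extend_past P ks w)) A"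
    by (simp add: distr_map_lags measure_bind_pmf)
  finally show ?thesis
    by (simp add: bind_replicate_pmf_extend_past transition_def[abs_def])
qed

text \<open>On the lag event \<open>F\<close> the conditional probability of the block event is
  \<open>g\<close>, so the indicator of \<open>B\<close> and \<open>g\<close> have the same integral
  over \<open>F\<close>. Off \<open>F\<close> they differ by at most 1, and the mean of
  \<open>g\<close> is the probability under the run.\<close>

lemma abs_prob_diff_run_le:
  assumes K: "b \<le> int K" "int n \<le> b + int K"
  shows "\<bar>prob {\<omega> \<in> space C. recent n (past_at (path \<omega>) b) \<in> S} - measure (run transition N w) {v. recent n v \<in> S}\<bar>
    \<le> prob {\<omega> \<in> space C. \<not> b - int N \<le> regen_time (lags \<omega>) (- int K)}"
proof -
  define B where "B = {\<omega> \<in> space C. recent n (past_at (path \<omega>) b) \<in> S}"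
  define F where "F = {\<omega> \<in> space C. b - int N \<le> regen_time (lags \<omega>) (- int K)}"
  define g where "g \<omega> = measure (extend_past P (map (lags \<omega>) [b - int N..b - 1]) w) {v. recent n v \<in> S}" for \<omega>
  have [measurable]: "F \<in> sets lag_algebra"
    unfolding F_def space_lag_algebra[symmetric] by measurable
  then have [measurable]: "F \<in> events"
    using subalgebra_lag_algebra by (auto simp: subalgebra_def)
  have [measurable]: "B \<in> events" unfolding B_def by measurable
  have [measurable]: "g \<in> borel_measurable C" unfolding g_def by measurable
  have g01: "0 \<le> g \<omega>" "g \<omega> \<le> 1" for \<omega> by (auto simp: g_def)
  have int_B: "integrable C (indicator B :: _ \<Rightarrow> real)"
    by (auto intro!: integrable_const_bound[where B = 1] simp: indicator_def)
  have int_g: "integrable C g"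
    using g01 by (auto intro!: integrable_const_bound[where B = 1])
  have int_FB: "integrable C (\<lambda>\<omega>. indicator F \<omega> * indicator B \<omega> :: real)"
    by (auto intro!: integrable_const_bound[where B = 1] simp: indicator_def)
  have int_Fg: "integrable C (\<lambda>\<omega>. indicator F \<omega> * g \<omega> :: real)"
    using g01 by (auto intro!: integrable_const_bound[where B = 1] simp: indicator_def)
  have "(\<integral>\<omega>. indicator F \<omega> * indicator B \<omega> \<partial>C) = (\<integral>\<omega>. indicator F \<omega> * real_cond_exp C lag_algebra (indicator B) \<omega> \<partial>C)"
    using int_FB by (intro lag.real_cond_exp_intg(2)[symmetric]) auto
  also have "\<dots> = (\<integral>\<omega>. indicator F \<omega> * g \<omega> \<partial>C)"
  proof (rule integral_cong_AE)
    show "AE \<omega> in C. indicator F \<omega> * real_cond_exp C lag_algebra (indicator B) \<omega> = indicator F \<omega> * g \<omega>"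
      using cond_exp_block[OF K, of N S w]
      by eventually_elim (auto simp: F_def B_def g_def indicator_def)
  qed auto
  finally have eq: "(\<integral>\<omega>. indicator F \<omega> * indicator B \<omega> \<partial>C) = (\<integral>\<omega>. indicator F \<omega> * g \<omega> \<partial>C)" .
  have "prob B - measure (run transition N w) {v. recent n v \<in> S} = (\<integral>\<omega>. indicator B \<omega> - g \<omega> \<partial>C)"
    using int_B int_g expectation_extend_past[of b N w "{v. recent n v \<in> S}", folded g_def] by simp
  \<comment> \<open>By \<open>eq\<close> the subtracted part integrates to 0; without it the
    integrand vanishes on \<open>F\<close>.\<close>
  also have "\<dots> = (\<integral>\<omega>. (indicator B \<omega> - g \<omega>) - (indicator F \<omega> * indicator B \<omega> - indicator F \<omega> * g \<omega>) \<partial>C)"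
    using int_B int_g int_FB int_Fg eq by simp
  also have "\<bar>\<dots>\<bar> \<le> (\<integral>\<omega>. \<bar>(indicator B \<omega> - g \<omega>) - (indicator F \<omega> * indicator B \<omega> - indicator F \<omega> * g \<omega>)\<bar> \<partial>C)"
    by (rule integral_abs_bound)
  also have "\<dots> \<le> (\<integral>\<omega>. indicator (space C - F) \<omega> \<partial>C)"
  proof (rule integral_mono)
    fix \<omega> assume "\<omega> \<in> space C"
    then show "\<bar>(indicator B \<omega> - g \<omega>) - (indicator F \<omega> * indicator B \<omega> - indicator F \<omega> * g \<omega>)\<bar>
        \<le> (indicator (space C - F) \<omega> :: real)"
      using g01[of \<omega>] by (auto simp: indicator_def)
  next
    show "integrable C (\<lambda>\<omega>. \<bar>(indicator B \<omega> - g \<omega>) - (indicator F \<omega> * indicator B \<omega> - indicator F \<omega> * g \<omega>)\<bar>)"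
      by (intro integrable_abs Bochner_Integration.integrable_diff int_B int_g int_FB int_Fg)
    show "integrable C (indicator (space C - F) :: _ \<Rightarrow> real)"
      by (auto intro!: integrable_const_bound[where B = 1] simp: indicator_def)
  qed
  also have "\<dots> = prob (space C - F)" by simp
  also have "space C - F = {\<omega> \<in> space C. \<not> b - int N \<le> regen_time (lags \<omega>) (- int K)}"
    by (auto simp: F_def)
  finally show ?thesis by (simp add: B_def)
qed

text \<open>The error is uniform in \<open>w\<close>, so the start may later be arbitrary or random.
  It tends to 0 because the regeneration time with index \<open>-K\<close> is an integer, hence at
  least \<open>b - N\<close> for large \<open>N\<close>.\<close>

lemma prob_block_approx:
  obtains \<epsilon> :: "nat \<Rightarrow> real" where "\<epsilon> \<longlonglongrightarrow> 0"
    "\<And>N w. \<bar>prob {\<omega> \<in> space C. recent n (past_at (path \<omega>) b) \<in> S}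
        - measure (run transition N w) {v. recent n v \<in> S}\<bar> \<le> \<epsilon> N"
proof -
  define K where "K = nat \<bar>b\<bar> + n"
  define F where "F N = {\<omega> \<in> space C. \<not> b - int N \<le> regen_time (lags \<omega>) (- int K)}" for N
  have [measurable]: "F N \<in> events" for N unfolding F_def by measurable
  have "(\<lambda>N. prob (F N)) \<longlonglongrightarrow> prob (\<Inter>N. F N)"
    by (rule finite_Lim_measure_decseq) (auto simp: F_def decseq_def)
  moreover have "(\<Inter>N. F N) = {}"
  proof -
    have "\<omega> \<notin> F (nat (b - regen_time (lags \<omega>) (- int K)))" for \<omega> by (simp add: F_def)
    then show ?thesis by blast
  qed
  ultimately have "(\<lambda>N. prob (F N)) \<longlonglongrightarrow> 0" by simp
  moreover have "b \<le> int K" "int n \<le> b + int K" by (auto simp: K_def)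
  ultimately show ?thesis
    using that[of "\<lambda>N. prob (F N)"] abs_prob_diff_run_le[of b K n S _ _] by (simp add: F_def)
qed

end

section \<open>Stationarity and marginals\<close>

lemma measurable_process_seq:
  "(\<And>n. X n \<in> measurable M (count_space UNIV)) \<Longrightarrow> (\<lambda>\<omega> n. X n \<omega>) \<in> measurable M seq_space"
  by (rule measurable_PiM_single') (auto simp: space_PiM)

lemma prob_space_process_law:
  "prob_space M \<Longrightarrow> (\<And>n. X n \<in> measurable M (count_space UNIV)) \<Longrightarrow> prob_space (process_law M X)"
  unfolding process_law_def by (intro prob_space.prob_space_distr measurable_process_seq)

lemma measure_process_law:
  assumes "\<And>n. X n \<in> measurable M (count_space UNIV)" "A \<in> sets seq_space"
  shows "measure (process_law M X) A = measure M {\<omega> \<in> space M. (\<lambda>n. X n \<omega>) \<in> A}"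
  unfolding process_law_def
  by (subst measure_distr[OF measurable_process_seq]) (use assms in \<open>auto intro!: arg_cong[of _ _ "measure M"]\<close>)

lemma sets_recent_past_at [measurable]:
  "{x :: int \<Rightarrow> 'b::countable. recent k (past_at x b) \<in> S} \<in> sets seq_space"
proof -
  have "{x \<in> space seq_space. recent k (past_at x b) \<in> S} \<in> sets (seq_space :: (int \<Rightarrow> 'b) measure)"
    by measurable
  then show ?thesis by (simp add: space_PiM)
qed

lemma process_law_eqI:
  fixes X :: "int \<Rightarrow> 'a \<Rightarrow> 'b::countable"
  assumes "prob_space M" "\<And>n. X n \<in> measurable M (count_space UNIV)"
    and "prob_space N" "\<And>n. Y n \<in> measurable N (count_space UNIV)"
    and eq: "\<And>k b S. measure M {\<omega> \<in> space M. recent k (past_at (\<lambda>n. X n \<omega>) b) \<in> S}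
        = measure N {\<omega> \<in> space N. recent k (past_at (\<lambda>n. Y n \<omega>) b) \<in> S}"
  shows "process_law M X = process_law N Y"
proof (rule seq_law_eqI)
  show "measure (process_law M X) {x. recent k (past_at x b) \<in> S}
      = measure (process_law N Y) {x. recent k (past_at x b) \<in> S}" for k b S
    using eq[of k b S] assms by (simp add: measure_process_law sets_recent_past_at)
  show "prob_space (process_law M X)" by (rule prob_space_process_law[OF assms(1,2)])
  show "prob_space (process_law N Y)" by (rule prob_space_process_law[OF assms(3,4)])
qed (simp_all add: process_law_def)

lemma eq_if_abs_diff_le_tendsto_0:
  fixes a b :: real
  assumes "\<epsilon> \<longlonglongrightarrow> 0" "\<And>N. \<bar>a - b\<bar> \<le> \<epsilon> N"
  shows "a = b"
proof -
  have "\<bar>a - b\<bar> \<le> 0" using assms by (intro LIMSEQ_le_const[OF assms(1)]) auto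
  then show ?thesis by simp
qed

section \<open>Invariance of the law of the past of a stationary chain\<close>

lemma case_nat_past: "past_at x 1 = case_nat (x 0) (past_at x 0)"
  using case_nat_past_at[of x 0] by simp

lemma run_Suc_bool:
  "measure (run p (Suc N) x) A = (\<Sum>a\<in>UNIV. pmf (p x) a * measure (run p N (case_nat a x)) A)"
  for p :: "(nat \<Rightarrow> 'b::finite) \<Rightarrow> 'b pmf"
  by (simp add: measure_bind_pmf integral_measure_pmf[where A = UNIV] mult.commute)

text \<open>Stationarity replaces the past at time 0 by the past at time 1, which is
  \<open>X 0\<close> followed by the past at time 0. Conditioning \<open>X 0\<close> on the latter
  brings in the kernel.\<close>

lemma stationary_chain_step:
  assumes chain: "stationary_chain M X p"
    and h[measurable]: "h \<in> borel_measurable seq_space" and h01: "\<And>u. 0 \<le> h u" "\<And>u. h u \<le> (1 :: real)"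
  shows "(\<integral>\<omega>. h (past_at (\<lambda>n. X n \<omega>) 0) \<partial>M)
    = (\<integral>\<omega>. (\<Sum>a\<in>UNIV. pmf (p (past_at (\<lambda>n. X n \<omega>) 0)) a * h (case_nat a (past_at (\<lambda>n. X n \<omega>) 0))) \<partial>M)"
proof -
  interpret prob_space M
    using chain by (simp add: stationary_chain_def stationary_process_def)
  have X[measurable]: "X n \<in> measurable M (count_space UNIV)" for n
    using chain by (simp add: stationary_chain_def stationary_process_def)
  have [measurable]: "(\<lambda>\<omega> n. X n \<omega>) \<in> measurable M seq_space"
    by (rule measurable_process_seq[OF X])
  have [measurable]: "(\<lambda>\<omega> n. X (n + 1) \<omega>) \<in> measurable M seq_space"
    by (rule measurable_process_seq[OF X])
  have p[measurable]: "(\<lambda>u. pmf (p u) a) \<in> borel_measurable seq_space" for a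
    using chain by (simp add: stationary_chain_def)
  let ?past = "\<lambda>\<omega>. past_at (\<lambda>n. X n \<omega>) 0"
  have sub: "subalgebra M (past_algebra M X)"
    unfolding subalgebra_def past_algebra_def
    by (auto simp: sets_vimage_algebra2 space_PiM intro!: measurable_sets[of ?past M seq_space])
  interpret past: finite_measure_subalgebra M "past_algebra M X"
    by unfold_locales (rule sub)
  have past_meas[measurable]: "?past \<in> measurable (past_algebra M X) seq_space"
    unfolding past_algebra_def by (rule measurable_vimage_algebra1) (auto simp: space_PiM)
  have int: "integrable M (\<lambda>\<omega>. h (case_nat a (?past \<omega>)) * indicator {\<omega> \<in> space M. X 0 \<omega> = a} \<omega>)" for a
    using h01 by (intro integrable_const_bound[where B = 1]) (auto simp: indicator_def)
  have "(\<integral>\<omega>. h (?past \<omega>) \<partial>M) = (\<integral>x. h (past_at x 0) \<partial>process_law M X)"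
    unfolding process_law_def by (subst integral_distr) auto
  also have "process_law M X = process_law M (\<lambda>n. X (n + 1))"
    using chain by (simp add: stationary_chain_def stationary_process_def)
  also have "(\<integral>x. h (past_at x 0) \<partial>\<dots>) = (\<integral>\<omega>. h (past_at (\<lambda>n. X (n + 1) \<omega>) 0) \<partial>M)"
    unfolding process_law_def by (subst integral_distr) auto
  \<comment> \<open>Splitting by the value of \<open>X 0\<close> fixes the new symbol in each term,
    so the factor with \<open>h\<close> depends on the past only.\<close>
  also have "\<dots> = (\<integral>\<omega>. (\<Sum>a\<in>UNIV. h (case_nat a (?past \<omega>)) * indicator {\<omega> \<in> space M. X 0 \<omega> = a} \<omega>) \<partial>M)"
  proof (rule Bochner_Integration.integral_cong[OF refl])
    fix \<omega> assume "\<omega> \<in> space M"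
    have "past_at (\<lambda>n. X (n + 1) \<omega>) 0 = past_at (\<lambda>n. X n \<omega>) 1"
      by (simp add: past_at_def)
    also have "\<dots> = case_nat (X 0 \<omega>) (?past \<omega>)" by (rule case_nat_past)
    finally show "h (past_at (\<lambda>n. X (n + 1) \<omega>) 0)
        = (\<Sum>a\<in>UNIV. h (case_nat a (?past \<omega>)) * indicator {\<omega> \<in> space M. X 0 \<omega> = a} \<omega>)"
      using \<open>\<omega> \<in> space M\<close> by (cases "X 0 \<omega>") (auto simp: UNIV_bool indicator_def)
  qed
  also have "\<dots> = (\<Sum>a\<in>UNIV. \<integral>\<omega>. h (case_nat a (?past \<omega>)) * indicator {\<omega> \<in> space M. X 0 \<omega> = a} \<omega> \<partial>M)"
    by (rule Bochner_Integration.integral_sum) (rule int)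
  also have "\<dots> = (\<Sum>a\<in>UNIV. \<integral>\<omega>. pmf (p (?past \<omega>)) a * h (case_nat a (?past \<omega>)) \<partial>M)"
  proof (rule sum.cong[OF refl])
    fix a
    have "(\<integral>\<omega>. h (case_nat a (?past \<omega>)) * indicator {\<omega> \<in> space M. X 0 \<omega> = a} \<omega> \<partial>M)
      = (\<integral>\<omega>. h (case_nat a (?past \<omega>)) * real_cond_exp M (past_algebra M X) (indicator {\<omega> \<in> space M. X 0 \<omega> = a}) \<omega> \<partial>M)"
      using int by (intro past.real_cond_exp_intg(2)[symmetric]) auto
    also have "\<dots> = (\<integral>\<omega>. pmf (p (?past \<omega>)) a * h (case_nat a (?past \<omega>)) \<partial>M)"
    proof (rule integral_cong_AE)
      have "AE \<omega> in M. real_cond_exp M (past_algebra M X) (indicator {\<omega> \<in> space M. X 0 \<omega> = a}) \<omega> = pmf (p (?past \<omega>)) a"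
        using chain by (simp add: stationary_chain_def)
      then show "AE \<omega> in M. h (case_nat a (?past \<omega>)) * real_cond_exp M (past_algebra M X) (indicator {\<omega> \<in> space M. X 0 \<omega> = a}) \<omega>
          = pmf (p (?past \<omega>)) a * h (case_nat a (?past \<omega>))"
        by eventually_elim simp
    qed measurable
    finally show "(\<integral>\<omega>. h (case_nat a (?past \<omega>)) * indicator {\<omega> \<in> space M. X 0 \<omega> = a} \<omega> \<partial>M)
      = (\<integral>\<omega>. pmf (p (?past \<omega>)) a * h (case_nat a (?past \<omega>)) \<partial>M)" .
  qed
  also have "\<dots> = (\<integral>\<omega>. (\<Sum>a\<in>UNIV. pmf (p (?past \<omega>)) a * h (case_nat a (?past \<omega>))) \<partial>M)"
    using h01 by (intro Bochner_Integration.integral_sum[symmetric] integrable_const_bound[where B = 1])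
      (auto simp: pmf_le_1 mult_le_one)
  finally show ?thesis .
qed

text \<open>The law of the past is invariant for the chain on pasts. Measurability in the start is
  part of the induction, since \<open>stationary_chain_step\<close> is applied to the probability
  under the run as a function of the start.\<close>

lemma stationary_chain_run:
  assumes chain: "stationary_chain M X p" and A: "A \<in> sets seq_space"
  shows "(\<lambda>x. measure (run p N x) A) \<in> borel_measurable seq_space
    \<and> measure M {\<omega> \<in> space M. past_at (\<lambda>n. X n \<omega>) 0 \<in> A} = (\<integral>\<omega>. measure (run p N (past_at (\<lambda>n. X n \<omega>) 0)) A \<partial>M)"
proof (induction N)
  case 0
  have meas: "(\<lambda>x. measure (run p 0 x) A) = indicator A"
    by (auto simp: fun_eq_iff indicator_def)
  have [measurable]: "X n \<in> measurable M (count_space UNIV)" for n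
    using chain by (simp add: stationary_chain_def stationary_process_def)
  have [measurable]: "(\<lambda>\<omega> n. X n \<omega>) \<in> measurable M seq_space"
    by (rule measurable_process_seq) measurable
  have "measure M {\<omega> \<in> space M. past_at (\<lambda>n. X n \<omega>) 0 \<in> A}
      = (\<integral>\<omega>. indicator {\<omega> \<in> space M. past_at (\<lambda>n. X n \<omega>) 0 \<in> A} \<omega> \<partial>M)"
    by (simp add: Int_absorb2 subset_eq)
  also have "\<dots> = (\<integral>\<omega>. indicator A (past_at (\<lambda>n. X n \<omega>) 0) \<partial>M)"
    by (rule Bochner_Integration.integral_cong) (auto simp: indicator_def)
  finally show ?case
    using A unfolding meas[THEN fun_cong] by simp
next
  case (Suc N)
  then have [measurable]: "(\<lambda>x. measure (run p N x) A) \<in> borel_measurable seq_space" by blast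
  have [measurable]: "(\<lambda>x. measure (run p N (case_nat a x)) A) \<in> borel_measurable seq_space" for a
    by (rule measurable_compose[OF measurable_case_nat_seq]) measurable
  have [measurable]: "(\<lambda>u. pmf (p u) a) \<in> borel_measurable seq_space" for a
    using chain by (simp add: stationary_chain_def)
  show ?case
    unfolding run_Suc_bool
    using Suc stationary_chain_step[OF chain, of "\<lambda>x. measure (run p N x) A"]
    by (auto simp del: sum.cong)
qed

lemma stationary_process_block:
  fixes X :: "int \<Rightarrow> 'a \<Rightarrow> 'b::countable"
  assumes "stationary_process M X"
  shows "measure M {\<omega> \<in> space M. recent k (past_at (\<lambda>n. X n \<omega>) b) \<in> S}
    = measure M {\<omega> \<in> space M. recent k (past_at (\<lambda>n. X n \<omega>) 0) \<in> S}"
proof -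
  have X: "X n \<in> measurable M (count_space UNIV)" for n
    using assms by (simp add: stationary_process_def)
  have "process_law M (\<lambda>n. X (n + b)) = process_law M X"
    using assms by (simp add: stationary_process_def)
  then have "measure (process_law M (\<lambda>n. X (n + b))) {x. recent k (past_at x 0) \<in> S}
      = measure (process_law M X) {x. recent k (past_at x 0) \<in> S}" by simp
  moreover have "past_at (\<lambda>n. X (n + b) \<omega>) 0 = past_at (\<lambda>n. X n \<omega>) b" for \<omega>
    by (simp add: past_at_def algebra_simps)
  ultimately show ?thesis
    using X by (simp add: measure_process_law sets_recent_past_at)
qed

section \<open>Stationarity and marginal laws of the regenerative process\<close>

context regenerative_process
begin

text \<open>Blocks of equal length ending at \<open>b\<close> and \<open>b'\<close> are approximated
  by the same run, so their laws coincide.\<close>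

lemma stationary_process_path: "stationary_process C Z"
  unfolding stationary_process_def
proof (intro conjI allI)
  fix m
  have "prob {\<omega> \<in> space C. recent k (past_at (path \<omega>) b) \<in> S} = prob {\<omega> \<in> space C. recent k (past_at (path \<omega>) b') \<in> S}"
    for k b b' and S :: "'s list set"
  proof -
    obtain \<epsilon> where e: "\<epsilon> \<longlonglongrightarrow> 0" "\<And>N w. \<bar>prob {\<omega> \<in> space C. recent k (past_at (path \<omega>) b) \<in> S}
        - measure (run transition N w) {v. recent k v \<in> S}\<bar> \<le> \<epsilon> N"
      using prob_block_approx[of k b S] by blast
    obtain \<epsilon>' where e': "\<epsilon>' \<longlonglongrightarrow> 0" "\<And>N w. \<bar>prob {\<omega> \<in> space C. recent k (past_at (path \<omega>) b') \<in> S}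
        - measure (run transition N w) {v. recent k v \<in> S}\<bar> \<le> \<epsilon>' N"
      using prob_block_approx[of k b' S] by blast
    show ?thesis
    proof (rule eq_if_abs_diff_le_tendsto_0)
      show "(\<lambda>N. \<epsilon> N + \<epsilon>' N) \<longlonglongrightarrow> 0" using tendsto_add[OF e(1) e'(1)] by simp
      show "\<bar>prob {\<omega> \<in> space C. recent k (past_at (path \<omega>) b) \<in> S}
          - prob {\<omega> \<in> space C. recent k (past_at (path \<omega>) b') \<in> S}\<bar> \<le> \<epsilon> N + \<epsilon>' N" for N
        \<comment> \<open>Any start serves, since both bounds are uniform in it;
          \<open>undefined\<close> is an arbitrary past.\<close>
        using e(2)[of N undefined] e'(2)[of N undefined] by linarith
    qed
  qed
  moreover have "past_at (\<lambda>n. Z (n + m) \<omega>) b = past_at (path \<omega>) (b + m)" for \<omega> b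
    by (simp add: past_at_def algebra_simps)
  ultimately show "process_law C (\<lambda>n. Z (n + m)) = process_law C Z"
    by (intro process_law_eqI) (auto simp: prob_space_axioms)
qed (auto simp: prob_space_axioms)

text \<open>A run started in the closed set \<open>W\<close> stays in \<open>W\<close>, and the
  block approximation with blocks of length one transfers this to the process.\<close>

lemma prob_path_notin:
  assumes closed: "\<And>v s. v \<in> W \<Longrightarrow> s \<in> set_pmf (transition v) \<Longrightarrow> case_nat s v \<in> W" and "w \<in> W"
  shows "prob {\<omega> \<in> space C. Z n \<omega> \<notin> (\<lambda>v. v 0) ` W} = 0"
proof -
  define S where "S = {[s] | s. s \<notin> (\<lambda>v. v 0) ` W}"
  have S: "recent 1 v \<in> S \<longleftrightarrow> v 0 \<notin> (\<lambda>v. v 0) ` W" for v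
    by (auto simp: S_def recent_def)
  obtain \<epsilon> where e: "\<epsilon> \<longlonglongrightarrow> 0" "\<And>N w. \<bar>prob {\<omega> \<in> space C. recent 1 (past_at (path \<omega>) (n + 1)) \<in> S}
        - measure (run transition N w) {v. recent 1 v \<in> S}\<bar> \<le> \<epsilon> N"
    using prob_block_approx[of 1 "n + 1" S] by blast
  have "measure (run transition N w) {v. recent 1 v \<in> S} = 0" for N
    unfolding measure_pmf_zero_iff S using set_pmf_run[of W transition w N] assms by auto
  then have "prob {\<omega> \<in> space C. recent 1 (past_at (path \<omega>) (n + 1)) \<in> S} = 0"
    using e(2)[of _ w] by (intro eq_if_abs_diff_le_tendsto_0[OF e(1)]) simp
  then show ?thesis by (simp only: S) (simp add: past_at_def)
qed

text \<open>Every past of the chain lifts to \<open>W\<close>, where the run of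
  \<open>transition\<close> projects onto the run of \<open>p\<close>. So runs of \<open>p\<close>
  approximate the projected blocks uniformly in the start; averaging the start over the invariant
  law of the past of \<open>X\<close> gives the block probabilities of \<open>X\<close>.\<close>

lemma process_law_marginal:
  fixes f :: "'s \<Rightarrow> bool"
  assumes chain: "stationary_chain M X p"
    and marginal: "\<And>v. v \<in> W \<Longrightarrow> map_pmf f (transition v) = p (f \<circ> v)"
    and closed: "\<And>v s. v \<in> W \<Longrightarrow> s \<in> set_pmf (transition v) \<Longrightarrow> case_nat s v \<in> W"
    and lift: "\<And>x. \<exists>w\<in>W. f \<circ> w = x"
  shows "process_law C (\<lambda>n \<omega>. f (Z n \<omega>)) = process_law M X"
proof -
  have stat: "stationary_process M X" and M: "prob_space M"
    and X[measurable]: "X n \<in> measurable M (count_space UNIV)" for n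
    using chain by (auto simp: stationary_chain_def stationary_process_def)
  interpret M: prob_space M by (rule M)
  have [measurable]: "(\<lambda>\<omega> n. X n \<omega>) \<in> measurable M seq_space"
    by (rule measurable_process_seq) measurable
  show ?thesis
  proof (rule process_law_eqI)
    fix k b and S :: "bool list set"
    define a where "a = prob {\<omega> \<in> space C. recent k (past_at (\<lambda>n. f (Z n \<omega>)) b) \<in> S}"
    define A where "A = {v. recent k v \<in> S}"
    have A: "A \<in> sets seq_space"
    proof -
      have "{v \<in> space seq_space. recent k v \<in> S} \<in> sets seq_space" by measurable
      then show ?thesis by (simp add: A_def space_PiM)
    qed
    have recent_map: "recent k (past_at (\<lambda>n. f (Z n \<omega>)) b) = map f (recent k (past_at (path \<omega>) b))" for \<omega>
      by (simp add: recent_def past_at_def)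
    obtain \<epsilon> where e: "\<epsilon> \<longlonglongrightarrow> 0" "\<And>N w. \<bar>a - measure (run transition N w) {v. recent k v \<in> {h. map f h \<in> S}}\<bar> \<le> \<epsilon> N"
      using prob_block_approx[of k b "{h. map f h \<in> S}"] unfolding a_def recent_map mem_Collect_eq by blast
    have approx: "\<bar>a - measure (run p N x) A\<bar> \<le> \<epsilon> N" for N x
    proof -
      obtain w where w: "w \<in> W" "f \<circ> w = x" using lift by blast
      have "measure (run p N x) A = measure (map_pmf ((\<circ>) f) (run transition N w)) A"
        using map_run[of W f transition p w N] marginal closed w by simp
      also have "\<dots> = measure (run transition N w) {v. recent k v \<in> {h. map f h \<in> S}}"
        by (simp add: measure_map_pmf A_def vimage_def recent_comp)
      finally show ?thesis using e(2) by simp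
    qed
    have "\<bar>a - measure M {\<omega> \<in> space M. past_at (\<lambda>n. X n \<omega>) 0 \<in> A}\<bar> \<le> \<epsilon> N" for N
    proof -
      let ?g = "\<lambda>\<omega>. measure (run p N (past_at (\<lambda>n. X n \<omega>) 0)) A"
      have [measurable]: "(\<lambda>x. measure (run p N x) A) \<in> borel_measurable seq_space"
        using stationary_chain_run[OF chain A] by blast
      have int: "integrable M ?g" by (intro M.integrable_const_bound[where B = 1]) auto
      have "a - measure M {\<omega> \<in> space M. past_at (\<lambda>n. X n \<omega>) 0 \<in> A} = (\<integral>\<omega>. a - ?g \<omega> \<partial>M)"
        using int stationary_chain_run[OF chain A, of N] by (simp add: M.prob_space)
      also have "\<bar>\<dots>\<bar> \<le> (\<integral>\<omega>. \<bar>a - ?g \<omega>\<bar> \<partial>M)" by (rule integral_abs_bound)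
      also have "\<dots> \<le> (\<integral>\<omega>. \<epsilon> N \<partial>M)"
        using int approx by (intro integral_mono) auto
      also have "\<dots> = \<epsilon> N" by (simp add: M.prob_space)
      finally show ?thesis .
    qed
    then have "a = measure M {\<omega> \<in> space M. past_at (\<lambda>n. X n \<omega>) 0 \<in> A}"
      by (rule eq_if_abs_diff_le_tendsto_0[OF e(1)])
    then show "prob {\<omega> \<in> space C. recent k (past_at (\<lambda>n. f (Z n \<omega>)) b) \<in> S}
        = measure M {\<omega> \<in> space M. recent k (past_at (\<lambda>n. X n \<omega>) b) \<in> S}"
      using stationary_process_block[OF stat, of k b S] by (simp add: a_def A_def)
  qed (auto simp: prob_space_axioms M)
qed

end

section \<open>Attaining the distance\<close>

text \<open>If the second coordinate is true, then the first is true or the two differ, whence the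
  bound. For ordered pairs these cases are disjoint and each forces the second coordinate to be
  true, whence equality.\<close>

lemma prob_diff_le_coupling:
  assumes "stationary_coupling C Z \<mu> \<nu>"
  shows "measure \<nu> {x. x 0} - measure \<mu> {x. x 0} \<le> measure C {\<omega> \<in> space C. fst (Z 0 \<omega>) \<noteq> snd (Z 0 \<omega>)}"
    and "(AE \<omega> in C. fst (Z 0 \<omega>) \<le> snd (Z 0 \<omega>)) \<Longrightarrow>
      measure C {\<omega> \<in> space C. fst (Z 0 \<omega>) \<noteq> snd (Z 0 \<omega>)} = measure \<nu> {x. x 0} - measure \<mu> {x. x 0}"
proof -
  interpret prob_space C
    using assms by (simp add: stationary_coupling_def stationary_process_def)
  have Z[measurable]: "Z n \<in> measurable C (count_space UNIV)" for n
    using assms by (simp add: stationary_coupling_def stationary_process_def)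
  have [measurable]: "(\<lambda>\<omega>. fst (Z n \<omega>)) \<in> measurable C (count_space UNIV)"
    "(\<lambda>\<omega>. snd (Z n \<omega>)) \<in> measurable C (count_space UNIV)" for n
    by (auto intro: measurable_compose[OF Z])
  have "{x \<in> space seq_space. x 0} \<in> sets (seq_space :: (int \<Rightarrow> bool) measure)" by measurable
  then have A: "{x. x 0} \<in> sets (seq_space :: (int \<Rightarrow> bool) measure)" by (simp add: space_PiM)
  define F where "F = {\<omega> \<in> space C. fst (Z 0 \<omega>)}"
  define G where "G = {\<omega> \<in> space C. snd (Z 0 \<omega>)}"
  define D where "D = {\<omega> \<in> space C. fst (Z 0 \<omega>) \<noteq> snd (Z 0 \<omega>)}"
  have [measurable]: "F \<in> events" "G \<in> events" "D \<in> events" by (simp_all add: F_def G_def D_def)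
  have "measure \<mu> {x. x 0} = measure (process_law C (\<lambda>n \<omega>. fst (Z n \<omega>))) {x. x 0}"
    using assms by (simp add: stationary_coupling_def)
  then have \<mu>: "measure \<mu> {x. x 0} = prob F"
    using A by (simp add: measure_process_law F_def)
  have "measure \<nu> {x. x 0} = measure (process_law C (\<lambda>n \<omega>. snd (Z n \<omega>))) {x. x 0}"
    using assms by (simp add: stationary_coupling_def)
  then have \<nu>: "measure \<nu> {x. x 0} = prob G"
    using A by (simp add: measure_process_law G_def)
  have "prob G \<le> prob (F \<union> D)"
    by (rule finite_measure_mono) (auto simp: F_def G_def D_def)
  also have "\<dots> \<le> prob F + prob D" by (rule measure_Un_le) auto
  finally show "measure \<nu> {x. x 0} - measure \<mu> {x. x 0} \<le> measure C {\<omega> \<in> space C. fst (Z 0 \<omega>) \<noteq> snd (Z 0 \<omega>)}"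
    by (simp add: \<mu> \<nu> D_def)
  assume le: "AE \<omega> in C. fst (Z 0 \<omega>) \<le> snd (Z 0 \<omega>)"
  have "prob G = prob (F \<union> D)"
    by (rule finite_measure_eq_AE) (use le in \<open>auto simp: F_def G_def D_def\<close>)
  also have "\<dots> = prob F + prob (D - F)"
    by (subst finite_measure_Union'[symmetric]) auto
  also have "prob (D - F) = prob D"
    by (rule finite_measure_eq_AE) (use le in \<open>auto simp: F_def G_def D_def\<close>)
  finally show "measure C {\<omega> \<in> space C. fst (Z 0 \<omega>) \<noteq> snd (Z 0 \<omega>)} = measure \<nu> {x. x 0} - measure \<mu> {x. x 0}"
    by (simp add: \<mu> \<nu> D_def)
qed

text \<open>\<open>dbar\<close> ranges over coordinate processes on the sequence space, so a
  coupling on another space enters it through its law.\<close>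

lemma stationary_coupling_process_law:
  assumes "stationary_coupling C Z \<mu> \<nu>"
  shows "stationary_coupling (process_law C Z) (\<lambda>n w. w n) \<mu> \<nu>"
    and "measure (process_law C Z) {w \<in> space (process_law C Z). fst (w 0) \<noteq> snd (w 0)}
      = measure C {\<omega> \<in> space C. fst (Z 0 \<omega>) \<noteq> snd (Z 0 \<omega>)}"
proof -
  have C: "prob_space C" and Z: "Z n \<in> measurable C (count_space UNIV)" for n
    using assms by (simp_all add: stationary_coupling_def stationary_process_def)
  \<comment> \<open>One identity covers the shifts, with \<open>f\<close> the identity, and both
    marginals, with \<open>f\<close> a projection and \<open>m = 0\<close>.\<close>
  have comp: "process_law (process_law C Z) (\<lambda>n w. f (w (n + m))) = process_law C (\<lambda>n \<omega>. f (Z (n + m) \<omega>))"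
    for f :: "bool \<times> bool \<Rightarrow> 'b" and m
    unfolding process_law_def
    by (subst distr_distr)
       (auto simp: comp_def space_PiM intro!: measurable_process_seq Z measurable_PiM_single')
  show "stationary_coupling (process_law C Z) (\<lambda>n w. w n) \<mu> \<nu>"
    unfolding stationary_coupling_def stationary_process_def
  proof (intro conjI allI)
    show "prob_space (process_law C Z)" using C Z by (rule prob_space_process_law)
    show "(\<lambda>w. w n) \<in> measurable (process_law C Z) (count_space UNIV)" for n
      by (simp add: process_law_def)
    show "process_law (process_law C Z) (\<lambda>n w. w (n + m)) = process_law (process_law C Z) (\<lambda>n w. w n)" for m
      using comp[of "\<lambda>x. x" m] comp[of "\<lambda>x. x" 0] assms
      by (simp add: stationary_coupling_def stationary_process_def)
    show "process_law (process_law C Z) (\<lambda>n w. fst (w n)) = \<mu>"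
      using comp[of fst 0] assms by (simp add: stationary_coupling_def)
    show "process_law (process_law C Z) (\<lambda>n w. snd (w n)) = \<nu>"
      using comp[of snd 0] assms by (simp add: stationary_coupling_def)
  qed
  have [measurable]: "Measurable.pred seq_space (\<lambda>w :: int \<Rightarrow> bool \<times> bool. fst (w 0) \<noteq> snd (w 0))"
    by (rule measurable_compose[OF measurable_component_singleton]) auto
  have "{w \<in> space seq_space. fst (w 0) \<noteq> snd (w 0)} \<in> sets (seq_space :: (int \<Rightarrow> bool \<times> bool) measure)"
    by measurable
  then show "measure (process_law C Z) {w \<in> space (process_law C Z). fst (w 0) \<noteq> snd (w 0)}
      = measure C {\<omega> \<in> space C. fst (Z 0 \<omega>) \<noteq> snd (Z 0 \<omega>)}"
    using Z by (simp add: measure_process_law space_PiM process_law_def[of C Z, THEN arg_cong[of _ _ space]])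
qed

text \<open>For an ordered coupling the mismatch probability is a difference of marginal
  probabilities that bounds every coupling from below, so the infimum is a minimum.\<close>

lemma dbar_eq_if_ordered_coupling:
  assumes coupling: "stationary_coupling C Z \<mu> \<nu>"
    and le: "AE \<omega> in C. fst (Z 0 \<omega>) \<le> snd (Z 0 \<omega>)"
  shows "measure C {\<omega> \<in> space C. fst (Z 0 \<omega>) \<noteq> snd (Z 0 \<omega>)} = dbar \<mu> \<nu>"
  unfolding dbar_def
proof (rule cInf_eq_minimum[symmetric], safe)
  show "\<exists>C'. measure C {\<omega> \<in> space C. fst (Z 0 \<omega>) \<noteq> snd (Z 0 \<omega>)}
      = measure C' {w \<in> space C'. fst (w 0) \<noteq> snd (w 0)} \<and> stationary_coupling C' (\<lambda>n w. w n) \<mu> \<nu>"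
    using stationary_coupling_process_law[OF coupling] by (intro exI[of _ "process_law C Z"]) simp
next
  fix C' :: "(int \<Rightarrow> bool \<times> bool) measure"
  assume "stationary_coupling C' (\<lambda>n w. w n) \<mu> \<nu>"
  then show "measure C {\<omega> \<in> space C. fst (Z 0 \<omega>) \<noteq> snd (Z 0 \<omega>)}
      \<le> measure C' {w \<in> space C'. fst (w 0) \<noteq> snd (w 0)}"
    using prob_diff_le_coupling(1)[of C' "\<lambda>n w. w n" \<mu> \<nu>] prob_diff_le_coupling(2)[OF coupling le] by simp
qed

section \<open>The coupled kernel on ordered pasts and the conclusion\<close>

lemma sum_lag_prob: "(\<Sum>k\<le>m. lag_prob pX pY k) = alpha pX pY m"
  by (induction m) (auto simp: lag_prob_def)

lemma pmf_bool_eqI: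
  fixes p p' :: "bool pmf"
  assumes "pmf p a = pmf p' a"
  shows "p = p'"
proof (rule pmf_eqI)
  have "pmf r True + pmf r False = 1" for r :: "bool pmf"
    using sum_pmf_eq_1[OF finite subset_UNIV, of r] by (simp add: UNIV_bool)
  then show "pmf p b = pmf p' b" for b
    using assms by (cases a; cases b) (smt (verit))+
qed

lemma recent_ordered: "w \<in> ordered_pasts \<Longrightarrow> recent k w \<in> ordered_strings k"
  by (auto simp: ordered_pasts_def ordered_strings_def recent_def)

lemma case_nat_ordered: "w \<in> ordered_pasts \<Longrightarrow> s \<in> ordered_pairs \<Longrightarrow> case_nat s w \<in> ordered_pasts"
  by (auto simp: ordered_pasts_def split: nat.split)

theorem theorem6:
  fixes M :: "'a measure" and X :: "int \<Rightarrow> 'a \<Rightarrow> bool"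
    and N :: "'b measure" and Y :: "int \<Rightarrow> 'b \<Rightarrow> bool"
    and pX pY :: "(nat \<Rightarrow> bool) \<Rightarrow> bool pmf"
    and P :: "(bool \<times> bool) list \<Rightarrow> (bool \<times> bool) pmf"
    and C :: "'c measure" and L :: "int \<Rightarrow> 'c \<Rightarrow> nat" and Z :: "int \<Rightarrow> 'c \<Rightarrow> bool \<times> bool"
  assumes "stationary_chain M X pX"
    and "stationary_chain N Y pY"
    and ordering: "\<And>x y. x \<le> y \<Longrightarrow> pmf (pX x) True \<le> pmf (pY y) True"
    and continuity: "(\<lambda>k. max (beta pX k) (beta pY k)) \<longlonglongrightarrow> 0"
    and product: "convergent_prod (alpha pX pY)" "0 < (\<Prod>k. alpha pX pY k)"
    and "kernel_mixture pX pY P"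
    and "regenerative_construction C (lag_prob pX pY) P L Z"
  shows "stationary_coupling C Z (process_law M X) (process_law N Y) \<and>
         measure C {\<omega> \<in> space C. fst (Z 0 \<omega>) \<noteq> snd (Z 0 \<omega>)} = dbar (process_law M X) (process_law N Y)"
proof -
  interpret prob_space C
    using assms by (simp add: regenerative_construction_def)
  \<comment> \<open>The partial sums of \<open>lag_prob\<close> telescope to \<open>alpha\<close>,
    so the hypothesis on the product is the one that the locale asks for.\<close>
  interpret regenerative_process C "lag_prob pX pY" P L Z
    using assms by unfold_locales (simp_all add: sum_lag_prob)
  have set_transition: "set_pmf (transition w) \<subseteq> ordered_pairs" if "w \<in> ordered_pasts" for w
    using that recent_ordered assms(7) by (fastforce simp: transition_def kernel_mixture_def)
  have pmf_transition: "pmf (transition w) s = coupled_kernel pX pY s w"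
    if "w \<in> ordered_pasts" "s \<in> ordered_pairs" for w s
  proof -
    have sums: "(\<lambda>k. lag_prob pX pY k * pmf (P (recent k w)) s) sums coupled_kernel pX pY s w"
      using that assms(7) by (simp add: kernel_mixture_def)
    have int: "integrable (count_space UNIV) (\<lambda>k. pmf lag_pmf k * pmf (P (recent k w)) s)"
    proof -
      have "integrable (measure_pmf lag_pmf) (\<lambda>k. pmf (P (recent k w)) s)"
        by (rule measure_pmf.integrable_const_bound[where B = 1]) (auto simp: pmf_le_1)
      then show ?thesis
        unfolding measure_pmf_eq_density by (subst (asm) integrable_density) auto
    qed
    have "pmf (transition w) s = (\<integral>k. pmf lag_pmf k * pmf (P (recent k w)) s \<partial>count_space UNIV)"
      unfolding transition_def pmf_bind measure_pmf_eq_density by (subst integral_density) auto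
    also have "\<dots> = (\<Sum>k. lag_prob pX pY k * pmf (P (recent k w)) s)"
      using int by (simp add: integral_count_space_nat pmf_lag_pmf)
    finally show ?thesis using sums by (simp add: sums_iff)
  qed
  have closed: "case_nat s w \<in> ordered_pasts" if "w \<in> ordered_pasts" "s \<in> set_pmf (transition w)" for w s
    using that set_transition case_nat_ordered by blast
  \<comment> \<open>The diagonal pair lifts \<open>x\<close> in both coordinates, so one lift serves
    both marginals.\<close>
  have lift: "\<exists>w\<in>ordered_pasts. (fst \<circ> w = x) \<and> snd \<circ> w = x" for x :: "nat \<Rightarrow> bool"
    by (intro bexI[of _ "\<lambda>i. (x i, x i)"]) (auto simp: ordered_pasts_def ordered_pairs_def comp_def)
  have fst_transition: "map_pmf fst (transition w) = pX (fst \<circ> w)" if w: "w \<in> ordered_pasts" for w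
  proof (rule pmf_bool_eqI[where a = True])
    \<comment> \<open>Among ordered pairs, only \<open>(True, True)\<close> has a true first
      coordinate, and there the coupled kernel is given by \<open>pX\<close> alone. Likewise
      \<open>(False, False)\<close> gives the second marginal through \<open>pY\<close>.\<close>
    have "pmf (map_pmf fst (transition w)) True = measure (transition w) {(True, True)}"
      unfolding pmf_map using set_transition[OF w]
      by (intro measure_pmf.finite_measure_eq_AE) (auto simp: AE_measure_pmf_iff ordered_pairs_def)
    then show "pmf (map_pmf fst (transition w)) True = pmf (pX (fst \<circ> w)) True"
      using pmf_transition[OF w, of "(True, True)"] by (simp add: measure_pmf_single ordered_pairs_def)
  qed
  have snd_transition: "map_pmf snd (transition w) = pY (snd \<circ> w)" if w: "w \<in> ordered_pasts" for w
  proof (rule pmf_bool_eqI[where a = False])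
    have "pmf (map_pmf snd (transition w)) False = measure (transition w) {(False, False)}"
      unfolding pmf_map using set_transition[OF w]
      by (intro measure_pmf.finite_measure_eq_AE) (auto simp: AE_measure_pmf_iff ordered_pairs_def)
    then show "pmf (map_pmf snd (transition w)) False = pmf (pY (snd \<circ> w)) False"
      using pmf_transition[OF w, of "(False, False)"] by (simp add: measure_pmf_single ordered_pairs_def)
  qed
  have coupling: "stationary_coupling C Z (process_law M X) (process_law N Y)"
    unfolding stationary_coupling_def
    using process_law_marginal[OF assms(1) fst_transition closed] process_law_marginal[OF assms(2) snd_transition closed]
      lift stationary_process_path by blast
  moreover have "AE \<omega> in C. fst (Z 0 \<omega>) \<le> snd (Z 0 \<omega>)"
  proof -
    obtain w where "w \<in> ordered_pasts" using lift by blast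
    \<comment> \<open>Symbols occurring in ordered pasts are ordered pairs, so this null event is
      what the order at time 0 requires.\<close>
    then have "prob {\<omega> \<in> space C. Z 0 \<omega> \<notin> (\<lambda>v. v 0) ` ordered_pasts} = 0"
      using closed by (intro prob_path_notin) auto
    then have "AE \<omega> in C. \<omega> \<notin> {\<omega> \<in> space C. Z 0 \<omega> \<notin> (\<lambda>v. v 0) ` ordered_pasts}"
      by (subst prob_eq_0[symmetric]) auto
    then show ?thesis
      using AE_space by eventually_elim (auto simp: ordered_pasts_def ordered_pairs_def dest!: spec[where x = 0])
  qed
  ultimately show ?thesis
    using dbar_eq_if_ordered_coupling by blast
qed

end
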